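(* Let $X$ be a non-empty compact Hausdorff space, $\sigma:X\to X$ a homeomorphism, and $\Sigma=(X,\sigma)$. The following are equivalent: (1) If $I_1$ and $I_2$ are two non-zero closed ideals of $\ell^1(\Sigma)$, then $I_1\cap I_2\neq\{0\}$. (2) If $I_1$ and $I_2$ are two non-zero self-adjoint closed ideals of $\ell^1(\Sigma)$, then $I_1\cap I_2\neq\{0\}$. (3) $X$ has an infinite number of points, and $\Sigma$ is topologically transitive.
   Context: Let $\alpha$ be the automorphism of $C(X)$ (continuous complex-valued functions with supremum norm $\|\cdot\|_\infty$) given by $\alpha(f)=f\circ\sigma^{-1}$. The unital Banach $^*$-algebra $\ell^1(\Sigma)$ is the Banach space $\{a:\mathbb Z\to C(X) : \|a\|=\sum_{k\in\mathbb Z}\|a(k)\|_\infty<\infty\}$ with pointwise linear operations, product $(ab)(n)=\sum_{k\in\mathbb Z}a(k)\cdot\alpha^k(b(n-k))$ and involution $a^*(n)=\overline{\alpha^n(a(-n))}$. Ideals are two-sided. An ideal $I$ is self-adjoint if $a^*\in I$ for all $a\in I$. $\Sigma$ is topologically transitive if, for any pair of non-empty open subsets $U,V$ of $X$, there exists $n\in\mathbb Z$ such that $\sigma^n(U)\cap V\neq\emptyset$. *)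

theory Defs
  imports "HOL-Analysis.Analysis" "HOL-Algebra.Ideal"
begin

text \<open>
  The space \<open>X\<close> is the universe of a Hausdorff type \<open>'x\<close>, with compactness of \<open>UNIV\<close> as a
  hypothesis. Then every continuous function is bounded, so \<open>C(X)\<close> with the supremum norm is the
  library type \<open>'x \<Rightarrow>\<^sub>C complex\<close> of bounded continuous functions.
\<close>

definition bc_mult ::
    "('x::topological_space \<Rightarrow>\<^sub>C complex) \<Rightarrow> ('x \<Rightarrow>\<^sub>C complex) \<Rightarrow> ('x \<Rightarrow>\<^sub>C complex)" where
  "bc_mult f g = Bcontfun (\<lambda>x. apply_bcontfun f x * apply_bcontfun g x)"

definition bc_cnj :: "('x::topological_space \<Rightarrow>\<^sub>C complex) \<Rightarrow> ('x \<Rightarrow>\<^sub>C complex)" where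
  "bc_cnj f = Bcontfun (\<lambda>x. cnj (apply_bcontfun f x))"

lemma apply_bc_mult [simp]:
  "apply_bcontfun (bc_mult f g) x = apply_bcontfun f x * apply_bcontfun g x"
proof -
  have "bounded (range (\<lambda>x. apply_bcontfun f x * apply_bcontfun g x))"
    using bounded_apply_bcontfun[of f] bounded_apply_bcontfun[of g]
    by (auto simp: bounded_iff norm_mult intro!: mult_mono')
       (meson mult_mono' norm_ge_zero)
  then have "(\<lambda>x. apply_bcontfun f x * apply_bcontfun g x) \<in> bcontfun"
    by (simp add: bcontfun_def continuous_on_mult)
  then show ?thesis
    by (simp add: bc_mult_def Bcontfun_inverse)
qed

lemma apply_bc_cnj [simp]: "apply_bcontfun (bc_cnj f) x = cnj (apply_bcontfun f x)"
proof -
  have "(\<lambda>x. cnj (apply_bcontfun f x)) \<in> bcontfun"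
    using bounded_apply_bcontfun[of f]
    by (auto simp: bcontfun_def bounded_iff intro!: continuous_on_cnj)
  then show ?thesis
    by (simp add: bc_cnj_def Bcontfun_inverse)
qed

text \<open>Integer iterates; meaningful for bijective \<open>f\<close>. (HOL-Algebra overlays the \<open>inv\<close> syntax, hence
  \<open>inv_into UNIV\<close>.)\<close>

definition int_iter :: "('b \<Rightarrow> 'b) \<Rightarrow> int \<Rightarrow> 'b \<Rightarrow> 'b" where
  "int_iter f n = (if 0 \<le> n then f ^^ nat n else (inv_into UNIV f) ^^ nat (- n))"

text \<open>Meaningful for a homeomorphism \<open>\<sigma>\<close>, where \<open>Bcontfun\<close> is applied within its domain; see
  \<open>apply_alpha\<close>.\<close>

definition alpha ::
    "('x::topological_space \<Rightarrow> 'x) \<Rightarrow> ('x \<Rightarrow>\<^sub>C complex) \<Rightarrow> ('x \<Rightarrow>\<^sub>C complex)" where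
  "alpha \<sigma> f = Bcontfun (apply_bcontfun f \<circ> inv_into UNIV \<sigma>)"

lemma apply_alpha:
  assumes "homeomorphism UNIV UNIV \<sigma> (inv_into UNIV \<sigma>)"
  shows "apply_bcontfun (alpha \<sigma> f) x = apply_bcontfun f (inv_into UNIV \<sigma> x)"
proof -
  have "continuous_on UNIV (apply_bcontfun f \<circ> inv_into UNIV \<sigma>)"
    using assms by (intro continuous_on_compose) (auto simp: homeomorphism_def)
  moreover have "bounded (range (apply_bcontfun f \<circ> inv_into UNIV \<sigma>))"
    by (rule bounded_subset[OF bounded_apply_bcontfun[of f]]) auto
  ultimately have "(apply_bcontfun f \<circ> inv_into UNIV \<sigma>) \<in> bcontfun"
    by (simp add: bcontfun_def)
  then show ?thesis
    by (simp add: alpha_def Bcontfun_inverse)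
qed

definition ell1 :: "(int \<Rightarrow> ('x::topological_space \<Rightarrow>\<^sub>C complex)) set" where
  "ell1 = {a. (\<lambda>k. norm (a k)) summable_on UNIV}"

definition ell1_norm :: "(int \<Rightarrow> ('x::topological_space \<Rightarrow>\<^sub>C complex)) \<Rightarrow> real" where
  "ell1_norm a = (\<Sum>\<^sub>\<infinity>k. norm (a k))"

text \<open>The sum is taken in \<open>C(X)\<close>, that is, with respect to the supremum norm.\<close>

definition ell1_mult ::
    "('x::topological_space \<Rightarrow> 'x) \<Rightarrow> (int \<Rightarrow> ('x \<Rightarrow>\<^sub>C complex)) \<Rightarrow> (int \<Rightarrow> ('x \<Rightarrow>\<^sub>C complex))
      \<Rightarrow> (int \<Rightarrow> ('x \<Rightarrow>\<^sub>C complex))" where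
  "ell1_mult \<sigma> a b = (\<lambda>n. \<Sum>\<^sub>\<infinity>k. bc_mult (a k) (int_iter (alpha \<sigma>) k (b (n - k))))"

definition ell1_star ::
    "('x::topological_space \<Rightarrow> 'x) \<Rightarrow> (int \<Rightarrow> ('x \<Rightarrow>\<^sub>C complex)) \<Rightarrow> (int \<Rightarrow> ('x \<Rightarrow>\<^sub>C complex))" where
  "ell1_star \<sigma> a = (\<lambda>n. bc_cnj (int_iter (alpha \<sigma>) n (a (- n))))"

definition ell1_ring ::
    "('x::topological_space \<Rightarrow> 'x) \<Rightarrow> (int \<Rightarrow> ('x \<Rightarrow>\<^sub>C complex)) ring" where
  "ell1_ring \<sigma> =
    \<lparr> carrier = ell1,
      monoid.mult = ell1_mult \<sigma>,
      one = (\<lambda>n. if n = 0 then const_bcontfun 1 else 0),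
      zero = (\<lambda>n. 0),
      add = (\<lambda>a b n. a n + b n) \<rparr>"

definition ell1_topology :: "(int \<Rightarrow> ('x::topological_space \<Rightarrow>\<^sub>C complex)) topology" where
  "ell1_topology = Metric_space.mtopology ell1 (\<lambda>a b. ell1_norm (\<lambda>k. a k - b k))"

text \<open>
  The library's \<open>ideal\<close> is a two-sided ring ideal. Since the algebra is unital, such an ideal is
  automatically a complex linear subspace: the scalar multiple of \<open>a\<close> by \<open>c\<close> is the product of
  \<open>c\<close> times the unit with \<open>a\<close>.
\<close>

definition closed_ideal ::
    "('x::topological_space \<Rightarrow> 'x) \<Rightarrow> (int \<Rightarrow> ('x \<Rightarrow>\<^sub>C complex)) set \<Rightarrow> bool" where
  "closed_ideal \<sigma> I \<longleftrightarrow> ideal I (ell1_ring \<sigma>) \<and> closedin ell1_topology I"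

definition self_adjoint ::
    "('x::topological_space \<Rightarrow> 'x) \<Rightarrow> (int \<Rightarrow> ('x \<Rightarrow>\<^sub>C complex)) set \<Rightarrow> bool" where
  "self_adjoint \<sigma> I \<longleftrightarrow> (\<forall>a\<in>I. ell1_star \<sigma> a \<in> I)"

definition topologically_transitive :: "('x::topological_space \<Rightarrow> 'x) \<Rightarrow> bool" where
  "topologically_transitive \<sigma> \<longleftrightarrow>
    (\<forall>U V. open U \<and> U \<noteq> {} \<and> open V \<and> V \<noteq> {} \<longrightarrow> (\<exists>n::int. int_iter \<sigma> n ` U \<inter> V \<noteq> {}))"

end

theory Submission
  imports Defs
begin

text \<open>
  Write \<open>\<delta>\<close> for the unitary with \<open>\<delta> f \<delta>\<^sup>-\<^sup>1 = \<alpha>(f)\<close>, so that an element of the algebra is a series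
  \<open>\<Sum>\<^sub>k a(k) \<delta>\<^sup>k\<close>.

  Let \<open>X\<close> be infinite and the system topologically transitive. Then no nontrivial power of \<open>\<sigma>\<close> is the
  identity on a nonempty open set (\<open>ex_moved_point_pos\<close>). This makes it possible to cut an element of a
  nonzero closed ideal down to something close to a function of \<open>C(X)\<close>: multiplying from both sides by a
  function with small support kills any finite set of off-diagonal coefficients. A geometric series
  argument turns closeness into membership: every nonzero closed ideal contains a nonzero function
  (\<open>closed_ideal_contains_function\<close>). By transitivity, two functions have translates with nonzero
  product, so any two nonzero closed ideals meet (\<open>ideals_intersect\<close>).

  For the converse, two nonzero self-adjoint closed ideals with zero intersection have to be found when
  the system is not transitive or when \<open>X\<close> is finite. Since \<open>a a\<^sup>* = 0\<close> implies \<open>a = 0\<close>, annihilators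
  behave as in a semiprime ring, and an ideal and its annihilator intersect trivially. So it is enough
  to have nonzero \<open>c = c\<^sup>*\<close> and \<open>d\<close> with \<open>d x c = 0\<close> for all \<open>x\<close>
  (\<open>disjoint_ideals_of_zero_product\<close>). If open sets \<open>U\<close> and \<open>V\<close> violate transitivity, functions
  supported in them are such a pair. If \<open>X\<close> is finite, some \<open>\<sigma>\<^sup>p\<close> is the identity, \<open>\<delta>\<^sup>p\<close> is central, and
  the zero divisors \<open>\<bar>sin\<bar> + sin\<close> and \<open>\<bar>sin\<bar> - sin\<close> of the algebra of absolutely convergent Fourier
  series in \<open>\<delta>\<^sup>p\<close> serve as \<open>c\<close> and \<open>d\<close>. Up to a common factor the Fourier coefficients of \<open>\<bar>sin\<bar>\<close> are
  explicit rational numbers, and the identity \<open>\<bar>sin\<bar>\<^sup>2 = sin\<^sup>2\<close> comes down to telescoping sums (\<open>abs_sine_coeff_conv\<close>).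

  Identities in the algebra are verified by evaluating coefficients at points of \<open>X\<close>, where
  \<open>(a b)(n)\<close> takes at \<open>x\<close> the value \<open>\<Sum>\<^sub>k a(k)(x) \<cdot> b(n - k)(\<sigma>\<^sup>-\<^sup>k x)\<close> (\<open>apply_conv\<close>).
\<close>

section \<open>Integer iterates of a bijection\<close>

lemma int_iter_0 [simp]: "int_iter f 0 x = x"
  by (simp add: int_iter_def)

lemma int_iter_1: "int_iter f 1 x = f x"
  by (simp add: int_iter_def)

lemma int_iter_minus_1: "int_iter f (- 1) x = inv_into UNIV f x"
  by (simp add: int_iter_def)

lemma int_iter_plus_1:
  assumes "bij f"
  shows "int_iter f (n + 1) x = f (int_iter f n x)"
proof (cases "n \<ge> 0")
  case True
  then have "nat (n + 1) = Suc (nat n)" by simp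
  with True show ?thesis by (simp only: int_iter_def) simp
next
  case False
  define m where "m = nat (- (n + 1))"
  have m: "nat (- n) = Suc m" "nat (n + 1) = 0" "0 \<le> n + 1 \<longrightarrow> m = 0"
    using False by (auto simp: m_def)
  have "int_iter f (n + 1) x = (inv_into UNIV f ^^ m) x"
    using m unfolding int_iter_def m_def by auto
  moreover have "int_iter f n x = inv_into UNIV f ((inv_into UNIV f ^^ m) x)"
    using m False unfolding int_iter_def by simp
  ultimately show ?thesis
    using bij_is_surj[OF assms] by (simp add: surj_f_inv_f)
qed

lemma int_iter_add:
  assumes "bij f"
  shows "int_iter f (m + n) x = int_iter f m (int_iter f n x)"
proof (induction m rule: int_induct[where k = 0])
  case (step1 i)
  then show ?case
    using int_iter_plus_1[OF assms, of "i + n" x] int_iter_plus_1[OF assms, of i "int_iter f n x"]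
    by (simp add: ac_simps)
next
  case (step2 i)
  have "f (int_iter f (i - 1 + n) x) = f (int_iter f (i - 1) (int_iter f n x))"
    using int_iter_plus_1[OF assms, of "i - 1 + n" x] int_iter_plus_1[OF assms, of "i - 1" "int_iter f n x"] step2
    by (simp add: algebra_simps)
  then show ?case
    using bij_is_inj[OF assms] by (simp add: inj_eq)
qed simp

section \<open>Absolutely convergent series in \<open>C(X)\<close>\<close>

text \<open>
  For a general topological space as domain, convergence is obtained from the Weierstrass test: the
  pointwise sum is a uniform limit of continuous functions, hence is itself the sum in the supremum
  norm. It also shows that the sum may be computed pointwise, which reduces all identities between
  convolutions to identities between series of complex numbers.
\<close>

lemma
  fixes F :: "'i \<Rightarrow> ('a::topological_space \<Rightarrow>\<^sub>C 'b::banach)"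
  assumes "(\<lambda>k. norm (F k)) summable_on A"
  shows abs_summable_bcontfun: "F summable_on A"
    and apply_infsum_bcontfun: "apply_bcontfun (infsum F A) x = (\<Sum>\<^sub>\<infinity>k\<in>A. apply_bcontfun (F k) x)"
proof -
  define s where "s = (\<lambda>x. \<Sum>\<^sub>\<infinity>k\<in>A. apply_bcontfun (F k) x)"
  have sum_apply: "apply_bcontfun (sum F B) = (\<lambda>x. \<Sum>k\<in>B. apply_bcontfun (F k) x)" for B
    by (induction B rule: infinite_finite_induct) auto
  have lim: "uniform_limit UNIV (\<lambda>B x. \<Sum>k\<in>B. apply_bcontfun (F k) x) s (finite_subsets_at_top A)"
    unfolding s_def by (rule Weierstrass_m_test_general[OF _ assms]) (rule norm_bounded)
  have "continuous_on UNIV s"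
    by (rule uniform_limit_theorem[OF _ lim]) (auto intro!: always_eventually continuous_intros)
  moreover have "norm (s x) \<le> (\<Sum>\<^sub>\<infinity>k\<in>A. norm (F k))" for x
  proof -
    have *: "(\<lambda>k. norm (apply_bcontfun (F k) x)) summable_on A"
      by (rule Infinite_Sum.abs_summable_on_comparison_test'[OF assms]) (rule norm_bounded)
    have "norm (s x) \<le> (\<Sum>\<^sub>\<infinity>k\<in>A. norm (apply_bcontfun (F k) x))"
      unfolding s_def by (rule norm_infsum_bound[OF *])
    also have "\<dots> \<le> (\<Sum>\<^sub>\<infinity>k\<in>A. norm (F k))"
      by (rule infsum_mono[OF * assms]) (rule norm_bounded)
    finally show ?thesis .
  qed
  ultimately have "s \<in> bcontfun" by (rule bcontfun_normI)
  then obtain S where S: "s = apply_bcontfun S" by (rule bcontfunE)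
  have "(F has_sum S) A"
    unfolding has_sum_def
    by (rule uniform_limit_tendsto_bcontfun) (use lim in \<open>simp add: sum_apply S\<close>)
  then show "F summable_on A" "apply_bcontfun (infsum F A) x = (\<Sum>\<^sub>\<infinity>k\<in>A. apply_bcontfun (F k) x)"
    using S by (auto simp: s_def summable_on_def infsumI dest: fun_cong[of _ _ x])
qed

section \<open>Summable families of functions\<close>

lemma norm_bc_mult_le: "norm (bc_mult f g) \<le> norm f * norm g"
  by (rule norm_bound) (simp add: norm_mult mult_mono norm_bounded)

lemma ell1D: "a \<in> ell1 \<Longrightarrow> (\<lambda>k. norm (a k)) summable_on UNIV"
  by (simp add: ell1_def)

lemma ell1_norm_nonneg: "ell1_norm a \<ge> 0"
  by (simp add: ell1_norm_def infsum_nonneg)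

lemma norm_le_ell1_norm:
  assumes "a \<in> ell1"
  shows "norm (a k) \<le> ell1_norm a"
  using finite_sum_le_infsum[OF ell1D[OF assms], of "{k}"] by (simp add: ell1_norm_def)

lemma ell1I_comparison:
  assumes "g summable_on UNIV" "\<And>k. norm (a k) \<le> g k"
  shows "a \<in> ell1" "ell1_norm a \<le> infsum g UNIV"
proof -
  show *: "a \<in> ell1"
    unfolding ell1_def using Infinite_Sum.abs_summable_on_comparison_test'[of g UNIV a] assms by auto
  show "ell1_norm a \<le> infsum g UNIV"
    unfolding ell1_norm_def by (rule infsum_mono[OF ell1D[OF *] assms(1)]) (use assms in auto)
qed

lemma ell1_add:
  assumes "a \<in> ell1" "b \<in> ell1"
  shows "(\<lambda>k. a k + b k) \<in> ell1" "ell1_norm (\<lambda>k. a k + b k) \<le> ell1_norm a + ell1_norm b"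
  using ell1I_comparison[OF summable_on_add[OF ell1D ell1D], OF assms, of "\<lambda>k. a k + b k"]
    infsum_add[OF ell1D ell1D, OF assms]
  by (auto simp: ell1_norm_def norm_triangle_ineq)

lemma ell1_uminus: "a \<in> ell1 \<Longrightarrow> (\<lambda>k. - a k) \<in> ell1"
  by (simp add: ell1_def)

lemma ell1_diff:
  assumes "a \<in> ell1" "b \<in> ell1"
  shows "(\<lambda>k. a k - b k) \<in> ell1"
  using ell1_add(1)[OF assms(1) ell1_uminus[OF assms(2)]] by simp

lemma ell1_zero: "(\<lambda>k. 0) \<in> ell1"
  by (simp add: ell1_def)

lemma ell1_norm_eq_0:
  assumes "a \<in> ell1" "ell1_norm a \<le> 0"
  shows "a = (\<lambda>k. 0)"
proof
  fix k show "a k = 0"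
    using norm_le_ell1_norm[OF assms(1), of k] assms(2) by (metis norm_le_zero_iff order_trans)
qed

text \<open>
  The substitution \<open>n = k + m\<close> turns the summable product family into the family underlying the
  convolution. It makes the convolution series converge absolutely, and it gives the
  submultiplicativity of the norm.
\<close>

lemma ell1_product_summable:
  assumes "a \<in> ell1" "b \<in> ell1"
  shows "(\<lambda>(k, m). norm (a k) * norm (b m)) summable_on UNIV \<times> UNIV"
    and "(\<lambda>(k, n). norm (a k) * norm (b (n - k))) summable_on UNIV \<times> UNIV"
    and "(\<lambda>(n, k). norm (a k) * norm (b (n - k))) summable_on UNIV \<times> UNIV"
    and "(\<lambda>n. \<Sum>\<^sub>\<infinity>k. norm (a k) * norm (b (n - k))) summable_on UNIV"
    and "(\<Sum>\<^sub>\<infinity>n. \<Sum>\<^sub>\<infinity>k. norm (a k) * norm (b (n - k))) = ell1_norm a * ell1_norm b"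
proof -
  note sa = ell1D[OF assms(1)] and sb = ell1D[OF assms(2)]
  show 1: "(\<lambda>(k, m). norm (a k) * norm (b m)) summable_on UNIV \<times> UNIV"
    by (rule summable_on_SigmaI[where g = "\<lambda>k. norm (a k) * ell1_norm b"])
       (auto simp: ell1_norm_def sa sb intro!: has_sum_cmult_right summable_on_cmult_left)
  show 2: "(\<lambda>(k, n). norm (a k) * norm (b (n - k))) summable_on UNIV \<times> UNIV"
    by (subst summable_on_reindex_bij_witness[where i = "\<lambda>(k, m). (k, k + m)"
          and j = "\<lambda>(k, n). (k, n - k)" and h = "\<lambda>(k, m). norm (a k) * norm (b m)" and T = "UNIV \<times> UNIV"])
       (use 1 in auto)
  show 3: "(\<lambda>(n, k). norm (a k) * norm (b (n - k))) summable_on UNIV \<times> UNIV"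
    using 2 by (subst summable_on_swap) simp
  show "(\<lambda>n. \<Sum>\<^sub>\<infinity>k. norm (a k) * norm (b (n - k))) summable_on UNIV"
    using summable_on_Sigma_banach[OF 3] .
  have "(\<Sum>\<^sub>\<infinity>n. \<Sum>\<^sub>\<infinity>k. norm (a k) * norm (b (n - k))) = (\<Sum>\<^sub>\<infinity>k. \<Sum>\<^sub>\<infinity>n. norm (a k) * norm (b (n - k)))"
    by (rule infsum_swap_banach[OF 3])
  also have "\<dots> = (\<Sum>\<^sub>\<infinity>k. norm (a k) * (\<Sum>\<^sub>\<infinity>n. norm (b (n - k))))"
    by (simp add: infsum_cmult_right')
  also have "\<dots> = (\<Sum>\<^sub>\<infinity>k. norm (a k) * ell1_norm b)"
  proof -
    have "(\<Sum>\<^sub>\<infinity>n. norm (b (n - k))) = ell1_norm b" for k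
      unfolding ell1_norm_def
      by (rule infsum_reindex_bij_witness[where i = "\<lambda>m. m + k" and j = "\<lambda>n. n - k"]) auto
    then show ?thesis by simp
  qed
  also have "\<dots> = ell1_norm a * ell1_norm b"
    by (simp add: infsum_cmult_left' ell1_norm_def)
  finally show "(\<Sum>\<^sub>\<infinity>n. \<Sum>\<^sub>\<infinity>k. norm (a k) * norm (b (n - k))) = ell1_norm a * ell1_norm b" .
qed

lemma ell1_product_row_summable:
  assumes "a \<in> ell1" "b \<in> ell1"
  shows "(\<lambda>k. norm (a k) * norm (b (n - k))) summable_on UNIV"
  using summable_on_SigmaD1[where f = "\<lambda>n k. norm (a k) * norm (b (n - k))", OF ell1_product_summable(3)[OF assms], of n]
  by simp

section \<open>The Fourier coefficients of the absolute value of the sine\<close>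

text \<open>
  A sum over the integers splits into the nonnegative half and its mirror image under
  \<open>m \<mapsto> - 1 - m\<close>; this is the reflection under which \<open>1 / (2 m + 1)\<close> is odd.
\<close>

lemma has_sum_int:
  fixes f :: "int \<Rightarrow> 'a :: topological_comm_monoid_add"
  assumes "((\<lambda>n. f (int n)) has_sum A) UNIV" "((\<lambda>n. f (- 1 - int n)) has_sum B) UNIV"
  shows "(f has_sum (A + B)) UNIV"
proof -
  have "(f has_sum A) (range int)" "(f has_sum B) (range (\<lambda>n. - 1 - int n))"
    using assms by (subst has_sum_reindex; simp add: inj_def o_def)+
  then have "(f has_sum (A + B)) (range int \<union> range (\<lambda>n. - 1 - int n))"
    by (rule has_sum_Un_disjoint) auto
  moreover have "m \<in> range int \<union> range (\<lambda>n. - 1 - int n)" for m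
  proof (cases "m \<ge> 0")
    case True
    then show ?thesis by (auto intro: range_eqI[of _ _ "nat m"])
  next
    case False
    then have "m = - 1 - int (nat (- m - 1))" by simp
    then show ?thesis by blast
  qed
  ultimately show ?thesis
    by (metis UNIV_eq_I)
qed

lemma has_sum_diff_real:
  fixes f g :: "'i \<Rightarrow> real"
  assumes "(f has_sum s) A" "(g has_sum t) A"
  shows "((\<lambda>i. f i - g i) has_sum (s - t)) A"
  using has_sum_add[OF assms(1) has_sum_uminusI[OF assms(2)]] by simp

definition odd_recip :: "int \<Rightarrow> real" where
  "odd_recip m = 1 / (2 * of_int m + 1)"

lemma odd_nonzero: "2 * real_of_int m + 1 \<noteq> 0"
proof -
  have "2 * m + 1 \<noteq> 0" by presburger
  then show ?thesis by (metis of_int_1 of_int_add of_int_eq_0_iff of_int_mult of_int_numeral)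
qed

lemma odd_recip_reflect: "odd_recip (- 1 - m) = - odd_recip m"
  using odd_nonzero[of m] odd_nonzero[of "- 1 - m"] by (simp add: odd_recip_def field_simps)

lemma odd_recip_tendsto_0: "(\<lambda>n. odd_recip (int n)) \<longlonglongrightarrow> 0"
proof (rule real_tendsto_sandwich[OF _ _ tendsto_const LIMSEQ_inverse_real_of_nat])
  show "\<forall>\<^sub>F n in sequentially. 0 \<le> odd_recip (int n)"
    by (simp add: odd_recip_def)
  show "\<forall>\<^sub>F n in sequentially. odd_recip (int n) \<le> inverse (real (Suc n))"
    by (simp add: odd_recip_def field_simps)
qed

text \<open>
  Both halves telescope, since \<open>1 / (2 m + 1)\<close> tends to \<open>0\<close> at both ends. All but one of the
  differences are negative, so that convergence of the partial sums already gives unconditional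
  convergence.
\<close>

lemma odd_recip_telescope_1: "((\<lambda>m. odd_recip (m + 1) - odd_recip m) has_sum 0) UNIV"
proof -
  have "((\<lambda>n. odd_recip (int n) - odd_recip (int n + 1)) has_sum 1) UNIV"
  proof (rule sums_nonneg_imp_has_sum)
    show "(\<lambda>n. odd_recip (int n) - odd_recip (int n + 1)) sums 1"
      using telescope_sums'[OF odd_recip_tendsto_0] by (simp add: odd_recip_def add.commute)
  qed (simp add: odd_recip_def field_simps)
  then have 1: "((\<lambda>n. odd_recip (int n + 1) - odd_recip (int n)) has_sum - 1) UNIV"
    by (auto dest: has_sum_uminusI)
  have "((\<lambda>n. odd_recip (int n - 1) - odd_recip (int n)) has_sum - 1) UNIV"
  proof (rule sums_nonneg_imp_has_sum_strong)
    have "(\<lambda>n. odd_recip (int n - 1)) \<longlonglongrightarrow> 0"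
      by (rule LIMSEQ_imp_Suc) (use odd_recip_tendsto_0 in simp)
    from telescope_sums'[OF this]
    show "(\<lambda>n. odd_recip (int n - 1) - odd_recip (int n)) sums - 1"
      by (simp add: odd_recip_def)
    show "\<forall>\<^sub>F n in sequentially. 0 \<le> odd_recip (int n - 1) - odd_recip (int n)"
      using eventually_gt_at_top[of 0] by eventually_elim (auto simp: odd_recip_def field_simps gr0_conv_Suc)
  qed
  then have "((\<lambda>n. odd_recip (int n) - odd_recip (int n - 1)) has_sum 1) UNIV"
    by (auto dest: has_sum_uminusI)
  moreover have "odd_recip (- int n) - odd_recip (- 1 - int n) = odd_recip (int n) - odd_recip (int n - 1)" for n
    using odd_recip_reflect[of "int n - 1"] odd_recip_reflect[of "int n"] by simp
  ultimately have 2: "((\<lambda>n. odd_recip (- 1 - int n + 1) - odd_recip (- 1 - int n)) has_sum 1) UNIV"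
    by simp
  show ?thesis
    using has_sum_int[where f = "\<lambda>m. odd_recip (m + 1) - odd_recip m", OF 1 2] by simp
qed

lemma has_sum_int_translate:
  fixes f :: "int \<Rightarrow> 'a :: topological_comm_monoid_add"
  shows "((\<lambda>m. f (m + i)) has_sum s) UNIV \<longleftrightarrow> (f has_sum s) UNIV"
  by (rule has_sum_reindex_bij_witness[where i = "\<lambda>m. m - i" and j = "\<lambda>m. m + i"]) auto

lemma odd_recip_telescope: "((\<lambda>m. odd_recip (m + i) - odd_recip m) has_sum 0) UNIV"
proof (induction i rule: int_induct[where k = 0])
  case (step1 i)
  have "((\<lambda>m. odd_recip (m + i + 1) - odd_recip (m + i)) has_sum 0) UNIV"
    using odd_recip_telescope_1 has_sum_int_translate[of "\<lambda>m. odd_recip (m + 1) - odd_recip m" i 0] by simp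
  from has_sum_add[OF this step1(2)] show ?case by (simp add: ac_simps)
next
  case (step2 i)
  have "((\<lambda>m. odd_recip (m + i) - odd_recip (m + (i - 1))) has_sum 0) UNIV"
    using odd_recip_telescope_1 has_sum_int_translate[of "\<lambda>m. odd_recip (m + 1) - odd_recip m" "i - 1" 0]
    by (simp add: algebra_simps)
  from has_sum_diff_real[OF step2(2) this] show ?case by simp
qed simp

lemma odd_recip_square_summable: "(\<lambda>m. (odd_recip m)\<^sup>2) summable_on UNIV"
proof -
  have "summable (\<lambda>n. inverse (real (Suc n) ^ 2))"
    using inverse_power_summable[of 2, where ?'a = real] by (subst summable_Suc_iff) simp
  then have "summable (\<lambda>n. (odd_recip (int n))\<^sup>2)"
    by (rule summable_comparison_test'[where N = 0])
       (auto simp: odd_recip_def power_divide inverse_eq_divide intro!: divide_left_mono power_mono)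
  then have *: "(\<lambda>n. (odd_recip (int n))\<^sup>2) summable_on UNIV"
    by (rule summable_nonneg_imp_summable_on) simp
  then obtain s where s: "((\<lambda>n. (odd_recip (int n))\<^sup>2) has_sum s) UNIV"
    by (auto simp: summable_on_def)
  have "((\<lambda>n. (odd_recip (- 1 - int n))\<^sup>2) has_sum s) UNIV"
    using s by (simp add: odd_recip_reflect)
  from has_sum_int[where f = "\<lambda>m. (odd_recip m)\<^sup>2", OF s this]
  show ?thesis by (auto simp: summable_on_def)
qed

text \<open>
  The square of the norm of \<open>1 / (2 m + 1)\<close> in \<open>\<ell>\<^sup>2(\<int>)\<close>, which equals \<open>\<pi>\<^sup>2 / 4\<close>.
\<close>

definition odd_recip_norm :: real where
  "odd_recip_norm = (\<Sum>\<^sub>\<infinity>m. (odd_recip m)\<^sup>2)"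

lemma odd_recip_norm_pos: "odd_recip_norm > 0"
proof -
  have "(odd_recip 0)\<^sup>2 \<le> odd_recip_norm"
    unfolding odd_recip_norm_def using finite_sum_le_infsum[OF odd_recip_square_summable, of "{0}"] by simp
  then show ?thesis by (simp add: odd_recip_def)
qed

lemma odd_recip_prod_summable: "(\<lambda>m. odd_recip (m + i) * odd_recip (m + j)) summable_on UNIV"
proof -
  have sq: "(\<lambda>m. (odd_recip (m + i))\<^sup>2) summable_on UNIV" for i
    using odd_recip_square_summable has_sum_int_translate[of "\<lambda>m. (odd_recip m)\<^sup>2" i]
    by (auto simp: summable_on_def)
  have "norm (odd_recip (m + i) * odd_recip (m + j)) \<le> (odd_recip (m + i))\<^sup>2 + (odd_recip (m + j))\<^sup>2" for m
  proof -
    have "2 * (\<bar>odd_recip (m + i)\<bar> * \<bar>odd_recip (m + j)\<bar>) \<le> (odd_recip (m + i))\<^sup>2 + (odd_recip (m + j))\<^sup>2"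
      using sum_squares_bound[of "\<bar>odd_recip (m + i)\<bar>" "\<bar>odd_recip (m + j)\<bar>"] by (simp add: mult.assoc)
    moreover have "0 \<le> \<bar>odd_recip (m + i)\<bar> * \<bar>odd_recip (m + j)\<bar>" by simp
    ultimately show ?thesis unfolding real_norm_def abs_mult by linarith
  qed
  from Infinite_Sum.abs_summable_on_comparison_test'[OF summable_on_add[OF sq[of i] sq[of j]] this]
  show ?thesis by (rule abs_summable_summable)
qed

text \<open>
  The translates of \<open>1 / (2 m + 1)\<close> are orthogonal in \<open>\<ell>\<^sup>2(\<int>)\<close>: by partial fractions the product
  of two different translates is a multiple of their difference, and the sum of that difference
  telescopes to \<open>0\<close>. (Behind this, the sequence consists of the Fourier coefficients of a function of
  constant modulus.)
\<close>

lemma odd_recip_orthogonal: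
  "((\<lambda>m. odd_recip (m + i) * odd_recip (m + j)) has_sum (if i = j then odd_recip_norm else 0)) UNIV"
proof (cases "i = j")
  case True
  then show ?thesis
    using has_sum_int_translate[of "\<lambda>m. (odd_recip m)\<^sup>2" i odd_recip_norm] odd_recip_square_summable
    by (simp add: odd_recip_norm_def power2_eq_square)
next
  case False
  have "((\<lambda>m. odd_recip (m + i) - odd_recip (m + j)) has_sum 0) UNIV"
    using has_sum_diff_real[OF odd_recip_telescope[of i] odd_recip_telescope[of j]] by simp
  from has_sum_cmult_right[OF this, of "1 / (2 * (of_int j - of_int i))"]
  have "((\<lambda>m. 1 / (2 * (of_int j - of_int i)) * (odd_recip (m + i) - odd_recip (m + j))) has_sum 0) UNIV"
    by simp
  moreover have "1 / (2 * (of_int j - of_int i)) * (odd_recip (m + i) - odd_recip (m + j)) =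
      odd_recip (m + i) * odd_recip (m + j)" for m
  proof -
    have "odd_recip (m + i) - odd_recip (m + j)
        = 2 * (of_int j - of_int i) * (odd_recip (m + i) * odd_recip (m + j))"
      using odd_nonzero[of "m + i"] odd_nonzero[of "m + j"]
      by (simp add: odd_recip_def diff_frac_eq)
    then show ?thesis using False by simp
  qed
  ultimately show ?thesis using False by simp
qed

text \<open>
  The value is \<open>2 / (4 m\<^sup>2 - 1)\<close>, the coefficient of \<open>e\<^sup>2\<^sup>i\<^sup>m\<^sup>\<theta>\<close> in the Fourier series of
  \<open>- \<pi> \<bar>sin \<theta>\<bar>\<close>. Written as a difference of translates it inherits their orthogonality.
\<close>

definition abs_sine_coeff :: "int \<Rightarrow> real" where
  "abs_sine_coeff m = odd_recip (m - 1) - odd_recip m"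

lemma abs_sine_coeff_even: "abs_sine_coeff (- m) = abs_sine_coeff m"
  using odd_recip_reflect[of m] odd_recip_reflect[of "m - 1"] by (simp add: abs_sine_coeff_def minus_diff_commute)

lemma abs_sine_coeff_summable: "(\<lambda>m. norm (abs_sine_coeff m)) summable_on UNIV"
proof -
  have "abs_sine_coeff m = 2 * (odd_recip (m + - 1) * odd_recip (m + 0))" for m
    using odd_nonzero[of "m - 1"] odd_nonzero[of m]
    by (simp add: abs_sine_coeff_def odd_recip_def diff_frac_eq)
  then have "abs_sine_coeff summable_on UNIV"
    using summable_on_cmult_right[OF odd_recip_prod_summable[of "- 1" 0], of 2] by (simp cong: summable_on_cong)
  then show ?thesis
    by (subst summable_on_iff_abs_summable_on_real[symmetric])
qed

text \<open>
  This is the identity \<open>\<bar>sin \<theta>\<bar>\<^sup>2 = sin\<^sup>2 \<theta> = (2 - e\<^sup>2\<^sup>i\<^sup>\<theta> - e\<^sup>-\<^sup>2\<^sup>i\<^sup>\<theta>) / 4\<close> on the level of Fourier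
  coefficients. As the coefficients are even, their convolution is the autocorrelation of a difference
  of two orthogonal translates.
\<close>

lemma abs_sine_coeff_conv:
  "((\<lambda>m. abs_sine_coeff m * abs_sine_coeff (n - m)) has_sum
     odd_recip_norm * (if n = 0 then 2 else if n = 1 \<or> n = - 1 then - 1 else 0)) UNIV"
proof -
  let ?R = "\<lambda>i j. (if i = j then odd_recip_norm else 0)"
  have "((\<lambda>m. odd_recip (m + - 1) * odd_recip (m + (- n - 1)) - odd_recip (m + - 1) * odd_recip (m + - n)
       - odd_recip (m + 0) * odd_recip (m + (- n - 1)) + odd_recip (m + 0) * odd_recip (m + - n)) has_sum
      (?R (- 1) (- n - 1) - ?R (- 1) (- n) - ?R 0 (- n - 1) + ?R 0 (- n))) UNIV"
    by (intro has_sum_add has_sum_diff_real odd_recip_orthogonal)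
  moreover have "abs_sine_coeff m * abs_sine_coeff (n - m) =
      odd_recip (m + - 1) * odd_recip (m + (- n - 1)) - odd_recip (m + - 1) * odd_recip (m + - n)
       - odd_recip (m + 0) * odd_recip (m + (- n - 1)) + odd_recip (m + 0) * odd_recip (m + - n)" for m
  proof -
    have "abs_sine_coeff (n - m) = odd_recip (m + (- n - 1)) - odd_recip (m + - n)"
      using abs_sine_coeff_even[of "n - m"] by (simp add: abs_sine_coeff_def algebra_simps)
    moreover have "abs_sine_coeff m = odd_recip (m + - 1) - odd_recip (m + 0)"
      by (simp add: abs_sine_coeff_def)
    ultimately show ?thesis by (simp only: left_diff_distrib right_diff_distrib)
  qed
  moreover have "?R (- 1) (- n - 1) - ?R (- 1) (- n) - ?R 0 (- n - 1) + ?R 0 (- n)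
      = odd_recip_norm * (if n = 0 then 2 else if n = 1 \<or> n = - 1 then - 1 else 0)"
    by auto
  ultimately show ?thesis by simp
qed

section \<open>The action on points and on functions\<close>

locale dynamical_system =
  fixes \<sigma> :: "'x::t2_space \<Rightarrow> 'x"
  assumes compact_space: "compact (UNIV :: 'x set)"
    and homeo: "homeomorphism UNIV UNIV \<sigma> (inv_into UNIV \<sigma>)"
begin

lemma bij_sigma: "bij \<sigma>"
proof (rule bijI)
  show "inj \<sigma>" by (rule injI) (use homeo in \<open>metis homeomorphism_apply1 UNIV_I\<close>)
  show "surj \<sigma>" using homeo by (simp add: homeomorphism_def)
qed

abbreviation T :: "int \<Rightarrow> 'x \<Rightarrow> 'x" where "T \<equiv> int_iter \<sigma>"

lemmas T_add = int_iter_add[OF bij_sigma]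

lemma T_minus [simp]: "T (- n) (T n x) = x" "T n (T (- n) x) = x"
  using T_add[of "- n" n x] T_add[of n "- n" x] by simp_all

lemma continuous_T: "continuous_on UNIV (T n)"
proof -
  have "continuous_on UNIV (f ^^ m)" if "continuous_on UNIV f" for f :: "'x \<Rightarrow> 'x" and m
    by (induction m) (auto intro: continuous_on_compose2[OF that] simp: id_def)
  then show ?thesis
    using homeo by (simp add: int_iter_def homeomorphism_def)
qed

text \<open>
  The power \<open>\<alpha>\<^sup>n\<close> of the automorphism of \<open>C(X)\<close>.
\<close>

abbreviation shift :: "int \<Rightarrow> ('x \<Rightarrow>\<^sub>C complex) \<Rightarrow> ('x \<Rightarrow>\<^sub>C complex)" where
  "shift \<equiv> int_iter (alpha \<sigma>)"

lemma bij_alpha: "bij (alpha \<sigma>)"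
proof (rule bijI)
  have inv_s: "inv_into UNIV \<sigma> (\<sigma> x) = x" for x
    using bij_is_inj[OF bij_sigma] by simp
  show "inj (alpha \<sigma>)"
  proof (rule injI, rule bcontfun_eqI)
    fix f g x assume "alpha \<sigma> f = alpha \<sigma> g"
    then show "apply_bcontfun f x = apply_bcontfun g x"
      using apply_alpha[OF homeo, of f "\<sigma> x"] apply_alpha[OF homeo, of g "\<sigma> x"] by (simp add: inv_s)
  qed
  show "surj (alpha \<sigma>)"
  proof (rule surjI)
    fix g :: "'x \<Rightarrow>\<^sub>C complex"
    have "(\<lambda>x. g (\<sigma> x)) \<in> bcontfun"
      using continuous_T[of 1] by (intro bcontfun_normI[of _ "norm g"] norm_bounded)
        (auto simp: int_iter_1[abs_def] intro!: continuous_on_compose2[OF continuous_on_apply_bcontfun])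
    then show "alpha \<sigma> (Bcontfun (\<lambda>x. g (\<sigma> x))) = g"
      using bij_is_surj[OF bij_sigma]
      by (intro bcontfun_eqI) (simp add: apply_alpha[OF homeo] Bcontfun_inverse surj_f_inv_f)
  qed
qed

lemma apply_shift [simp]: "apply_bcontfun (shift n f) x = apply_bcontfun f (T (- n) x)"
proof (induction n arbitrary: x rule: int_induct[where k = 0])
  case (step1 i)
  have "T (- (i + 1)) x = T (- i) (inv_into UNIV \<sigma> x)"
    using T_add[of "- i" "- 1" x] by (simp add: int_iter_minus_1)
  then show ?case
    by (simp add: int_iter_plus_1[OF bij_alpha] apply_alpha[OF homeo] step1)
next
  case (step2 i)
  have "shift i f = alpha \<sigma> (shift (i - 1) f)"
    using int_iter_plus_1[OF bij_alpha, of "i - 1" f] by simp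
  then have "apply_bcontfun (shift (i - 1) f) x = shift i f (\<sigma> x)"
    using bij_is_inj[OF bij_sigma] by (simp add: apply_alpha[OF homeo])
  also have "\<dots> = f (T (- i) (T 1 x))"
    by (simp add: step2 int_iter_1)
  also have "\<dots> = f (T (- (i - 1)) x)"
    using T_add[of "- i" 1 x] by simp
  finally show ?case .
qed simp

lemma norm_shift [simp]: "norm (shift n f) = norm f"
proof (rule antisym)
  show "norm (shift n f) \<le> norm f"
    by (rule norm_bound) (simp add: norm_bounded)
  show "norm f \<le> norm (shift n f)"
  proof (rule norm_bound)
    show "norm (apply_bcontfun f x) \<le> norm (shift n f)" for x
      using norm_bounded[of "shift n f" "T n x"] by simp
  qed
qed

section \<open>The convolution ring\<close>

abbreviation conv (infixl "\<star>" 70) where "a \<star> b \<equiv> ell1_mult \<sigma> a b"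
abbreviation star where "star \<equiv> ell1_star \<sigma>"

lemma conv_term_le: "norm (bc_mult (a k) (shift k (b (n - k)))) \<le> norm (a k) * norm (b (n - k))"
  using norm_bc_mult_le[of "a k" "shift k (b (n - k))"] by simp

lemma apply_conv:
  assumes "a \<in> ell1" "b \<in> ell1"
  shows "apply_bcontfun ((a \<star> b) n) x = (\<Sum>\<^sub>\<infinity>k. a k x * b (n - k) (T (- k) x))"
proof -
  have "(\<lambda>k. norm (bc_mult (a k) (shift k (b (n - k))))) summable_on UNIV"
    by (rule Infinite_Sum.abs_summable_on_comparison_test'[OF ell1_product_row_summable[OF assms, of n]])
       (rule conv_term_le)
  then show ?thesis
    unfolding ell1_mult_def by (simp add: apply_infsum_bcontfun)
qed

lemma conv_summable:
  assumes "a \<in> ell1" "b \<in> ell1"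
  shows "(\<lambda>k. apply_bcontfun (a k) x * apply_bcontfun (b (n - k)) (y k)) summable_on UNIV"
  by (rule abs_summable_summable,
      rule Infinite_Sum.abs_summable_on_comparison_test'[OF ell1_product_row_summable[OF assms, of n]])
     (simp add: norm_mult mult_mono norm_bounded)

lemma
  assumes "a \<in> ell1" "b \<in> ell1"
  shows ell1_conv: "a \<star> b \<in> ell1"
    and ell1_norm_conv: "ell1_norm (a \<star> b) \<le> ell1_norm a * ell1_norm b"
proof -
  have "norm ((a \<star> b) n) \<le> (\<Sum>\<^sub>\<infinity>k. norm (a k) * norm (b (n - k)))" for n
    unfolding ell1_mult_def
    by (rule norm_infsum_le[OF has_sum_infsum has_sum_infsum conv_term_le]) 
       (intro abs_summable_bcontfun ell1_product_row_summable assms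
         Infinite_Sum.abs_summable_on_comparison_test'[OF ell1_product_row_summable[OF assms, of n]]
         conv_term_le)+
  from ell1I_comparison[OF ell1_product_summable(4)[OF assms] this]
  show "a \<star> b \<in> ell1" "ell1_norm (a \<star> b) \<le> ell1_norm a * ell1_norm b"
    by (simp_all add: ell1_product_summable(5)[OF assms])
qed

lemma ell1_eqI: "(\<And>n x. apply_bcontfun (a n) x = apply_bcontfun (b n) x) \<Longrightarrow> a = b"
  by (intro ext bcontfun_eqI)

text \<open>
  At a point, both sides are iterated sums of the same absolutely summable double family, so they agree
  by interchanging the sums and translating the index.
\<close>

lemma conv_assoc:
  assumes "a \<in> ell1" "b \<in> ell1" "c \<in> ell1"
  shows "(a \<star> b) \<star> c = a \<star> (b \<star> c)"
proof (rule ell1_eqI)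
  fix n x
  define F where "F = (\<lambda>j k. a j x * b (k - j) (T (- j) x) * c (n - k) (T (- k) x))"
  have "(\<lambda>z. norm (case z of (k, j) \<Rightarrow> F j k)) summable_on UNIV \<times> UNIV"
  proof (rule Infinite_Sum.abs_summable_on_comparison_test')
    show "(\<lambda>z. (case z of (k, j) \<Rightarrow> norm (a j) * norm (b (k - j))) * ell1_norm c) summable_on UNIV \<times> UNIV"
      by (rule summable_on_cmult_left[OF ell1_product_summable(3)[OF assms(1,2)]])
    show "norm (case z of (k, j) \<Rightarrow> F j k) \<le> (case z of (k, j) \<Rightarrow> norm (a j) * norm (b (k - j))) * ell1_norm c" for z
      using order_trans[OF norm_bounded norm_le_ell1_norm[OF assms(3)]]
      by (cases z) (auto simp: F_def norm_mult intro!: mult_mono norm_bounded)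
  qed
  then have F: "(\<lambda>(k, j). F j k) summable_on UNIV \<times> UNIV"
    by (rule abs_summable_summable)
  have "apply_bcontfun (((a \<star> b) \<star> c) n) x = (\<Sum>\<^sub>\<infinity>k. (\<Sum>\<^sub>\<infinity>j. a j x * b (k - j) (T (- j) x)) * c (n - k) (T (- k) x))"
    by (simp add: apply_conv assms ell1_conv)
  also have "\<dots> = (\<Sum>\<^sub>\<infinity>k. \<Sum>\<^sub>\<infinity>j. F j k)"
    by (simp add: F_def infsum_cmult_left')
  also have "\<dots> = (\<Sum>\<^sub>\<infinity>j. \<Sum>\<^sub>\<infinity>k. F j k)"
    by (rule infsum_swap_banach[OF F])
  also have "\<dots> = (\<Sum>\<^sub>\<infinity>j. \<Sum>\<^sub>\<infinity>l. a j x * (b l (T (- j) x) * c (n - j - l) (T (- l) (T (- j) x))))"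
  proof (rule infsum_cong)
    fix j
    show "(\<Sum>\<^sub>\<infinity>k. F j k) = (\<Sum>\<^sub>\<infinity>l. a j x * (b l (T (- j) x) * c (n - j - l) (T (- l) (T (- j) x))))"
      by (rule infsum_reindex_bij_witness[where i = "\<lambda>l. l + j" and j = "\<lambda>k. k - j"])
         (auto simp: F_def T_add[symmetric] mult.assoc)
  qed
  also have "\<dots> = apply_bcontfun ((a \<star> (b \<star> c)) n) x"
    by (simp add: apply_conv assms ell1_conv infsum_cmult_right')
  finally show "apply_bcontfun (((a \<star> b) \<star> c) n) x = apply_bcontfun ((a \<star> (b \<star> c)) n) x" .
qed

lemma conv_add_left:
  assumes "a \<in> ell1" "b \<in> ell1" "c \<in> ell1"
  shows "(\<lambda>k. a k + b k) \<star> c = (\<lambda>n. (a \<star> c) n + (b \<star> c) n)"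
  by (rule ell1_eqI)
     (simp add: apply_conv ell1_add assms distrib_right, intro infsum_add conv_summable assms)

lemma conv_add_right:
  assumes "a \<in> ell1" "b \<in> ell1" "c \<in> ell1"
  shows "a \<star> (\<lambda>k. b k + c k) = (\<lambda>n. (a \<star> b) n + (a \<star> c) n)"
  by (rule ell1_eqI)
     (simp add: apply_conv ell1_add assms distrib_left, intro infsum_add conv_summable assms)

lemma conv_uminus_left:
  assumes "a \<in> ell1" "b \<in> ell1"
  shows "(\<lambda>k. - a k) \<star> b = (\<lambda>n. - (a \<star> b) n)"
  by (rule ell1_eqI) (simp add: apply_conv ell1_uminus assms infsum_uminus)

lemma conv_uminus_right:
  assumes "a \<in> ell1" "b \<in> ell1"
  shows "a \<star> (\<lambda>k. - b k) = (\<lambda>n. - (a \<star> b) n)"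
  by (rule ell1_eqI) (simp add: apply_conv ell1_uminus assms infsum_uminus)

lemma conv_diff_left:
  assumes "a \<in> ell1" "b \<in> ell1" "c \<in> ell1"
  shows "(\<lambda>k. a k - b k) \<star> c = (\<lambda>n. (a \<star> c) n - (b \<star> c) n)"
  using conv_add_left[OF assms(1) ell1_uminus[OF assms(2)] assms(3)] conv_uminus_left[OF assms(2,3)] by simp

lemma conv_diff_right:
  assumes "a \<in> ell1" "b \<in> ell1" "c \<in> ell1"
  shows "a \<star> (\<lambda>k. b k - c k) = (\<lambda>n. (a \<star> b) n - (a \<star> c) n)"
  using conv_add_right[OF assms(1,2) ell1_uminus[OF assms(3)]] conv_uminus_right[OF assms(1,3)] by simp

lemma conv_zero: "(\<lambda>k. 0) \<star> a = (\<lambda>k. 0)" "a \<star> (\<lambda>k. 0) = (\<lambda>k. 0)"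
proof -
  have "bc_mult 0 f = 0" "bc_mult f 0 = 0" "shift n 0 = 0" for f :: "'x \<Rightarrow>\<^sub>C complex" and n
    by (auto intro!: bcontfun_eqI)
  then show "(\<lambda>k. 0) \<star> a = (\<lambda>k. 0)" "a \<star> (\<lambda>k. 0) = (\<lambda>k. 0)"
    by (auto simp: ell1_mult_def)
qed

text \<open>
  The element \<open>f \<delta>\<^sup>k\<close>, where \<open>\<delta>\<close> is the unitary that implements \<open>\<alpha>\<close>. For \<open>k = 0\<close> this is the
  embedding of \<open>C(X)\<close>.
\<close>

definition single :: "int \<Rightarrow> ('x \<Rightarrow>\<^sub>C complex) \<Rightarrow> (int \<Rightarrow> ('x \<Rightarrow>\<^sub>C complex))" where
  "single k f = (\<lambda>n. if n = k then f else 0)"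

lemma single_same [simp]: "single k f k = f"
  by (simp add: single_def)

lemma ell1_single [simp]: "single k f \<in> ell1"
  unfolding ell1_def single_def
  by (auto intro!: finite_nonzero_values_imp_summable_on intro: finite_subset[of _ "{k}"])

lemma infsum_single:
  fixes g :: "int \<Rightarrow> complex"
  assumes "\<And>j. j \<noteq> k \<Longrightarrow> g j = 0"
  shows "infsum g UNIV = g k"
proof -
  have "infsum g UNIV = infsum g {k}"
    by (rule infsum_cong_neutral) (use assms in auto)
  then show ?thesis by simp
qed

lemma apply_single_conv:
  assumes "a \<in> ell1"
  shows "apply_bcontfun ((single k f \<star> a) n) x = f x * a (n - k) (T (- k) x)"
  by (subst apply_conv[OF ell1_single assms], subst infsum_single[of k]) (auto simp: single_def)

lemma apply_conv_single:
  assumes "a \<in> ell1"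
  shows "apply_bcontfun ((a \<star> single k f) n) x = a (n - k) x * f (T (k - n) x)"
  by (subst apply_conv[OF assms ell1_single], subst infsum_single[of "n - k"]) (auto simp: single_def)

abbreviation unit where "unit \<equiv> single 0 (const_bcontfun 1)"

lemma conv_unit:
  assumes "a \<in> ell1"
  shows "unit \<star> a = a" "a \<star> unit = a"
  by (auto intro!: ell1_eqI simp: apply_single_conv apply_conv_single assms const_bcontfun.rep_eq)

lemma ring_sel [simp]:
  "carrier (ell1_ring \<sigma>) = ell1" "a \<otimes>\<^bsub>ell1_ring \<sigma>\<^esub> b = a \<star> b" "\<one>\<^bsub>ell1_ring \<sigma>\<^esub> = unit"
  "\<zero>\<^bsub>ell1_ring \<sigma>\<^esub> = (\<lambda>n. 0)" "a \<oplus>\<^bsub>ell1_ring \<sigma>\<^esub> b = (\<lambda>n. a n + b n)"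
  by (simp_all add: ell1_ring_def single_def)

lemma ring_ell1: "ring (ell1_ring \<sigma>)"
proof (rule ringI)
  show "abelian_group (ell1_ring \<sigma>)"
    by (rule abelian_groupI)
       (auto simp: ell1_add ell1_zero ac_simps intro!: bexI[OF _ ell1_uminus])
  show "Group.monoid (ell1_ring \<sigma>)"
    by (rule monoidI) (auto simp: ell1_conv conv_assoc conv_unit)
qed (auto simp: conv_add_left conv_add_right)

section \<open>The involution\<close>

lemma apply_star: "apply_bcontfun (star a n) x = cnj (a (- n) (T (- n) x))"
  by (simp add: ell1_star_def)

lemma ell1_star [simp]:
  assumes "a \<in> ell1"
  shows "star a \<in> ell1"
proof (rule ell1I_comparison(1))
  show "(\<lambda>n. norm (a (- n))) summable_on UNIV"
    by (subst summable_on_reindex_bij_witness[where i = uminus and j = uminus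
          and h = "\<lambda>n. norm (a n)" and T = UNIV])
       (use ell1D[OF assms] in auto)
  show "norm (star a n) \<le> norm (a (- n))" for n
    by (rule norm_bound) (simp add: apply_star norm_bounded)
qed

lemma star_star [simp]: "star (star a) = a"
  by (rule ell1_eqI) (simp add: apply_star)

lemma star_conv:
  assumes "a \<in> ell1" "b \<in> ell1"
  shows "star (a \<star> b) = star b \<star> star a"
proof (rule ell1_eqI)
  fix n x
  have "apply_bcontfun (star (a \<star> b) n) x = (\<Sum>\<^sub>\<infinity>k. cnj (a k (T (- n) x)) * cnj (b (- n - k) (T (- k) (T (- n) x))))"
    by (simp add: apply_star apply_conv assms flip: infsum_cnj)
  also have "\<dots> = (\<Sum>\<^sub>\<infinity>k. cnj (b (- k) (T (- k) x)) * cnj (a (k - n) (T (k - n) (T (- k) x))))"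
    by (rule infsum_reindex_bij_witness[where i = "\<lambda>k. k - n" and j = "\<lambda>k. k + n"])
       (auto simp: T_add[symmetric] minus_diff_commute)
  also have "\<dots> = apply_bcontfun ((star b \<star> star a) n) x"
    by (simp add: apply_star apply_conv assms)
  finally show "apply_bcontfun (star (a \<star> b) n) x = apply_bcontfun ((star b \<star> star a) n) x" .
qed

text \<open>
  The zeroth coefficient of \<open>a a\<^sup>*\<close> at a point is the sum of the squares of the moduli of all
  coefficients of \<open>a\<close> there. This positivity is what makes annihilators behave as in a semiprime ring.
\<close>

lemma conv_star_eq_0:
  assumes "a \<in> ell1" "a \<star> star a = (\<lambda>n. 0)"
  shows "a = (\<lambda>n. 0)"
proof (rule ell1_eqI)
  fix k x
  have "apply_bcontfun ((a \<star> star a) 0) x = (\<Sum>\<^sub>\<infinity>k. a k x * cnj (a k x))"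
    by (simp add: apply_conv assms(1) apply_star)
  also have "\<dots> = (\<Sum>\<^sub>\<infinity>k. of_real ((cmod (a k x))\<^sup>2))"
    by (simp only: complex_norm_square)
  finally have 0: "(\<Sum>\<^sub>\<infinity>k. complex_of_real ((cmod (a k x))\<^sup>2)) = 0"
    by (simp add: assms(2))
  have "(\<lambda>k. complex_of_real ((cmod (a k x))\<^sup>2)) summable_on UNIV"
    using conv_summable[OF assms(1) ell1_star[OF assms(1)], of x 0 "\<lambda>k. T (- k) x"]
    by (simp add: apply_star flip: complex_norm_square)
  with 0 have "complex_of_real ((cmod (a k x))\<^sup>2) = 0"
    by (intro nonneg_infsum_le_0D_complex[where A = UNIV and f = "\<lambda>k. complex_of_real ((cmod (a k x))\<^sup>2)"])
       (auto simp: less_eq_complex_def)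
  then show "apply_bcontfun (a k) x = apply_bcontfun 0 x"
    by simp
qed

section \<open>Closed ideals in terms of the norm\<close>

lemma metric_ell1: "Metric_space (ell1 :: (int \<Rightarrow> ('x \<Rightarrow>\<^sub>C complex)) set) (\<lambda>a b. ell1_norm (\<lambda>k. a k - b k))"
proof
  fix a b c :: "int \<Rightarrow> ('x \<Rightarrow>\<^sub>C complex)"
  show "0 \<le> ell1_norm (\<lambda>k. a k - b k)" by (rule ell1_norm_nonneg)
  show "ell1_norm (\<lambda>k. a k - b k) = ell1_norm (\<lambda>k. b k - a k)"
    by (simp add: ell1_norm_def norm_minus_commute)
  assume ab: "a \<in> ell1" "b \<in> ell1"
  show "(ell1_norm (\<lambda>k. a k - b k) = 0) = (a = b)"
  proof
    assume "ell1_norm (\<lambda>k. a k - b k) = 0"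
    then have "(\<lambda>k. a k - b k) = (\<lambda>k. 0)"
      by (intro ell1_norm_eq_0 ell1_diff ab) auto
    then show "a = b" by (auto simp: fun_eq_iff)
  qed (simp add: ell1_norm_def)
  assume "c \<in> ell1"
  then show "ell1_norm (\<lambda>k. a k - c k) \<le> ell1_norm (\<lambda>k. a k - b k) + ell1_norm (\<lambda>k. b k - c k)"
    using ell1_add(2)[of "\<lambda>k. a k - b k" "\<lambda>k. b k - c k"] ab by (simp add: ell1_diff)
qed

lemma closedin_ell1_iff:
  "closedin ell1_topology (C :: (int \<Rightarrow> ('x \<Rightarrow>\<^sub>C complex)) set) \<longleftrightarrow>
     C \<subseteq> ell1 \<and> (\<forall>a\<in>ell1 - C. \<exists>r>0. \<forall>b\<in>C. r \<le> ell1_norm (\<lambda>k. a k - b k))"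
  unfolding ell1_topology_def Metric_space.closedin_metric[OF metric_ell1]
  by (force simp: disjnt_iff Metric_space.in_mball[OF metric_ell1] not_less)

text \<open>
  This unfolds the ring record and the metric topology once and for all; being closed becomes a positive
  distance from every outside point.
\<close>

lemma closed_ideal_iff:
  "closed_ideal \<sigma> I \<longleftrightarrow> I \<subseteq> ell1 \<and> (\<lambda>n. 0) \<in> I \<and> (\<forall>a\<in>I. \<forall>b\<in>I. (\<lambda>n. a n - b n) \<in> I) \<and>
     (\<forall>a\<in>I. \<forall>b\<in>ell1. a \<star> b \<in> I \<and> b \<star> a \<in> I) \<and>
     (\<forall>a\<in>ell1 - I. \<exists>r>0. \<forall>b\<in>I. r \<le> ell1_norm (\<lambda>k. a k - b k))"
  (is "_ \<longleftrightarrow> ?sub \<and> ?zero \<and> ?diff \<and> ?abs \<and> ?cl")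
proof
  interpret R: ring "ell1_ring \<sigma>" by (rule ring_ell1)
  have minus: "\<ominus>\<^bsub>ell1_ring \<sigma>\<^esub> a = (\<lambda>n. - a n)" if "a \<in> ell1" for a
    by (rule R.minus_equality) (use that in \<open>auto simp: ell1_uminus\<close>)
  {
    assume "closed_ideal \<sigma> I"
    then interpret ideal I "ell1_ring \<sigma>" by (simp add: closed_ideal_def)
    have sub: "I \<subseteq> ell1" using a_subset by simp
    have "(\<lambda>n. a n - b n) \<in> I" if "a \<in> I" "b \<in> I" for a b
    proof -
      have "(\<lambda>n. - b n) \<in> I"
        using a_inv_closed[OF that(2)] minus[of b] that(2) sub by (metis subsetD)
      from a_closed[OF that(1) this] show ?thesis by (simp only: ring_sel) simp
    qed
    then show "?sub \<and> ?zero \<and> ?diff \<and> ?abs \<and> ?cl"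
      using \<open>closed_ideal \<sigma> I\<close> I_l_closed I_r_closed zero_closed
      by (simp add: closed_ideal_def closedin_ell1_iff)
  next
    assume *: "?sub \<and> ?zero \<and> ?diff \<and> ?abs \<and> ?cl"
    have uminus: "(\<lambda>n. - b n) \<in> I" if "b \<in> I" for b
    proof -
      from * have "(\<lambda>n. 0) \<in> I" "\<And>a b. a \<in> I \<Longrightarrow> b \<in> I \<Longrightarrow> (\<lambda>n. a n - b n) \<in> I" by auto
      from this(2)[OF this(1) that] show ?thesis by simp
    qed
    have add: "(\<lambda>n. a n + b n) \<in> I" if "a \<in> I" "b \<in> I" for a b
    proof -
      from * have "\<And>a b. a \<in> I \<Longrightarrow> b \<in> I \<Longrightarrow> (\<lambda>n. a n - b n) \<in> I" by auto
      from this[OF that(1) uminus[OF that(2)]] show ?thesis by simp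
    qed
    have "ideal I (ell1_ring \<sigma>)"
    proof (rule idealI[OF ring_ell1])
      show "subgroup I (add_monoid (ell1_ring \<sigma>))"
        by (rule R.add.subgroupI) (use * add uminus minus in \<open>auto simp flip: a_inv_def\<close>)
    qed (use * in auto)
    then show "closed_ideal \<sigma> I"
      using * by (simp add: closed_ideal_def closedin_ell1_iff)
  }
qed

section \<open>Annihilators\<close>

text \<open>
  The factor \<open>x\<close> between \<open>a\<close> and \<open>s\<close> makes this the annihilator of the two-sided ideal generated
  by \<open>S\<close>, and therefore an ideal itself.
\<close>

definition annihilator :: "(int \<Rightarrow> ('x \<Rightarrow>\<^sub>C complex)) set \<Rightarrow> (int \<Rightarrow> ('x \<Rightarrow>\<^sub>C complex)) set" where
  "annihilator S = {a \<in> ell1. \<forall>x\<in>ell1. \<forall>s\<in>S. a \<star> (x \<star> s) = (\<lambda>n. 0)}"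

lemma annihilatorD:
  assumes "a \<in> annihilator S" "x \<in> ell1" "s \<in> S"
  shows "a \<in> ell1" "a \<star> (x \<star> s) = (\<lambda>n. 0)"
  using assms by (auto simp: annihilator_def)

text \<open>
  Left and right annihilators agree: the element \<open>y = s x a\<close> satisfies
  \<open>y y\<^sup>* = s x (a (a\<^sup>* x\<^sup>*) s\<^sup>*) = 0\<close>, because \<open>s\<^sup>* \<in> S\<close>. Hence \<open>y = 0\<close>. This is also the reason why the
  annihilator is self-adjoint.
\<close>

lemma annihilator_sym:
  assumes S: "S \<subseteq> ell1" "\<forall>s\<in>S. star s \<in> S" and a: "a \<in> annihilator S" and x: "x \<in> ell1" and s: "s \<in> S"
  shows "s \<star> (x \<star> a) = (\<lambda>n. 0)"
proof (rule conv_star_eq_0)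
  have mem: "a \<in> ell1" "s \<in> ell1" "x \<in> ell1" using annihilatorD[OF a x s] S(1) s x by auto
  then show "s \<star> (x \<star> a) \<in> ell1" by (simp add: ell1_conv)
  have "(s \<star> (x \<star> a)) \<star> star (s \<star> (x \<star> a)) = (s \<star> x) \<star> (a \<star> ((star a \<star> star x) \<star> star s))"
    using mem by (simp add: star_conv ell1_conv conv_assoc)
  also have "a \<star> ((star a \<star> star x) \<star> star s) = (\<lambda>n. 0)"
    by (rule annihilatorD(2)[OF a]) (use S s mem in \<open>auto simp: ell1_conv\<close>)
  finally show "(s \<star> (x \<star> a)) \<star> star (s \<star> (x \<star> a)) = (\<lambda>n. 0)"
    by (simp add: conv_zero)
qed

lemma self_adjoint_annihilator:
  assumes S: "S \<subseteq> ell1" "\<forall>s\<in>S. star s \<in> S"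
  shows "self_adjoint \<sigma> (annihilator S)"
  unfolding self_adjoint_def
proof
  fix a assume a: "a \<in> annihilator S"
  then have a_ell1: "a \<in> ell1" by (simp add: annihilator_def)
  have "star a \<star> (x \<star> s) = (\<lambda>n. 0)" if x: "x \<in> ell1" and s: "s \<in> S" for x s
  proof -
    have [simp]: "s \<in> ell1" using S s by blast
    have "star s \<star> (star x \<star> a) = (\<lambda>n. 0)"
      by (rule annihilator_sym[OF S a]) (use S s x in auto)
    then have "star (star s \<star> (star x \<star> a)) = star (\<lambda>n. 0)" by simp
    moreover have "star (\<lambda>n. 0) = (\<lambda>n. 0)"
      by (rule ell1_eqI) (simp add: apply_star)
    ultimately show ?thesis
      using a_ell1 x by (simp add: star_conv ell1_conv conv_assoc)
  qed
  then show "star a \<in> annihilator S"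
    using a_ell1 by (simp add: annihilator_def)
qed

lemma closed_ideal_annihilator:
  assumes S: "S \<subseteq> ell1"
  shows "closed_ideal \<sigma> (annihilator S)"
  unfolding closed_ideal_iff
proof (intro conjI ballI)
  show "annihilator S \<subseteq> ell1" by (auto simp: annihilator_def)
  show "(\<lambda>n. 0) \<in> annihilator S" by (simp add: annihilator_def ell1_zero conv_zero)
next
  fix a b assume "a \<in> annihilator S" "b \<in> annihilator S"
  then show "(\<lambda>n. a n - b n) \<in> annihilator S"
    using S by (auto simp: annihilator_def ell1_diff conv_diff_left ell1_conv subset_iff)
next
  fix a b :: "int \<Rightarrow> ('x \<Rightarrow>\<^sub>C complex)" assume a: "a \<in> annihilator S" and b: "b \<in> ell1"
  have a_ell1: "a \<in> ell1" using a by (simp add: annihilator_def)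
  have "(a \<star> b) \<star> (x \<star> s) = (\<lambda>n. 0)" "(b \<star> a) \<star> (x \<star> s) = (\<lambda>n. 0)" if "x \<in> ell1" "s \<in> S" for x s
  proof -
    have [simp]: "s \<in> ell1" using S that by blast
    show "(a \<star> b) \<star> (x \<star> s) = (\<lambda>n. 0)"
      using annihilatorD(2)[OF a ell1_conv[OF b that(1)] that(2)] a_ell1 b that
      by (simp add: conv_assoc ell1_conv)
    show "(b \<star> a) \<star> (x \<star> s) = (\<lambda>n. 0)"
      using annihilatorD(2)[OF a that] a_ell1 b that
      by (simp add: conv_assoc ell1_conv conv_zero)
  qed
  then show "a \<star> b \<in> annihilator S" "b \<star> a \<in> annihilator S"
    using a_ell1 b by (simp_all add: annihilator_def ell1_conv)
next
  fix a assume "a \<in> ell1 - annihilator S"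
  then obtain x s where a: "a \<in> ell1" and x: "x \<in> ell1" "s \<in> S" and ne: "a \<star> (x \<star> s) \<noteq> (\<lambda>n. 0)"
    by (auto simp: annihilator_def)
  define p where "p = x \<star> s"
  have p: "p \<in> ell1" using x S by (auto simp: p_def ell1_conv)
  have pos: "ell1_norm (a \<star> p) > 0"
    using ne ell1_norm_eq_0[OF ell1_conv[OF a p]] by (force simp: p_def)
  \<comment> \<open>If \<open>b\<close> annihilates \<open>p\<close>, then \<open>\<parallel>a p\<parallel> = \<parallel>(a - b) p\<parallel> \<le> \<parallel>a - b\<parallel> \<parallel>p\<parallel>\<close>.\<close>
  show "\<exists>r>0. \<forall>b\<in>annihilator S. r \<le> ell1_norm (\<lambda>k. a k - b k)"
  proof (intro exI conjI ballI)
    show "0 < ell1_norm (a \<star> p) / (ell1_norm p + 1)"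
      using pos ell1_norm_nonneg[of p] by simp
    fix b assume b: "b \<in> annihilator S"
    then have b1: "b \<in> ell1" "b \<star> p = (\<lambda>n. 0)" using x by (auto simp: annihilator_def p_def)
    have "ell1_norm (a \<star> p) = ell1_norm ((\<lambda>k. a k - b k) \<star> p)"
      by (simp add: conv_diff_left a b1 p)
    also have "\<dots> \<le> ell1_norm (\<lambda>k. a k - b k) * ell1_norm p"
      by (rule ell1_norm_conv[OF ell1_diff[OF a b1(1)] p])
    also have "\<dots> \<le> ell1_norm (\<lambda>k. a k - b k) * (ell1_norm p + 1)"
      by (intro mult_left_mono ell1_norm_nonneg) simp
    finally show "ell1_norm (a \<star> p) / (ell1_norm p + 1) \<le> ell1_norm (\<lambda>k. a k - b k)"
      using ell1_norm_nonneg[of p] by (simp add: divide_le_eq)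
  qed
qed

text \<open>
  If \<open>a\<close> lies in both, then \<open>a\<close> annihilates \<open>a\<^sup>* \<in> I\<close>, that is \<open>a a\<^sup>* = 0\<close>.
\<close>

lemma annihilator_disjoint:
  assumes "closed_ideal \<sigma> I" "self_adjoint \<sigma> I"
  shows "I \<inter> annihilator I = {\<lambda>n. 0}"
proof -
  have "a = (\<lambda>n. 0)" if "a \<in> I" "a \<in> annihilator I" for a
  proof (rule conv_star_eq_0)
    show a: "a \<in> ell1" using that by (simp add: annihilator_def)
    have "star a \<in> I" using that(1) assms(2) by (simp add: self_adjoint_def)
    from annihilatorD(2)[OF that(2) ell1_single this, of 0 "const_bcontfun 1"]
    show "a \<star> star a = (\<lambda>n. 0)" by (simp add: conv_unit a)
  qed
  moreover have "(\<lambda>n. 0) \<in> I" "(\<lambda>n. 0) \<in> annihilator I"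
    using assms(1) closed_ideal_annihilator[of I] by (auto simp: closed_ideal_iff)
  ultimately show ?thesis by blast
qed

text \<open>
  The ideals are the annihilator of \<open>c\<close>, which contains \<open>d\<close>, and the annihilator of that ideal, which
  contains \<open>c\<close> by the symmetry of annihilation.
\<close>

lemma disjoint_ideals_of_zero_product:
  assumes "c \<in> ell1" "star c = c" "c \<noteq> (\<lambda>n. 0)" "d \<in> ell1" "d \<noteq> (\<lambda>n. 0)"
    and "\<And>x. x \<in> ell1 \<Longrightarrow> d \<star> (x \<star> c) = (\<lambda>n. 0)"
  shows "\<exists>I J. closed_ideal \<sigma> I \<and> self_adjoint \<sigma> I \<and> I \<noteq> {\<lambda>n. 0} \<and>
    closed_ideal \<sigma> J \<and> self_adjoint \<sigma> J \<and> J \<noteq> {\<lambda>n. 0} \<and> I \<inter> J = {\<lambda>n. 0}"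
proof -
  define I where "I = annihilator {c}"
  have S: "{c} \<subseteq> ell1" "\<forall>s\<in>{c}. star s \<in> {c}" using assms by auto
  have I: "closed_ideal \<sigma> I" "self_adjoint \<sigma> I"
    unfolding I_def using S by (auto intro: closed_ideal_annihilator self_adjoint_annihilator)
  then have sub: "I \<subseteq> ell1" "\<forall>s\<in>I. star s \<in> I"
    by (auto simp: closed_ideal_iff self_adjoint_def)
  have J: "closed_ideal \<sigma> (annihilator I)" "self_adjoint \<sigma> (annihilator I)"
    using closed_ideal_annihilator self_adjoint_annihilator sub by auto
  have "d \<in> I" using assms by (simp add: I_def annihilator_def)
  moreover have "c \<in> annihilator I"
    using annihilator_sym[OF S, folded I_def] assms(1) by (simp add: annihilator_def)
  ultimately show ?thesis
    using I J annihilator_disjoint[OF I] assms(3,5) by blast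
qed

section \<open>Functions with small support\<close>

lemma ex_bump:
  assumes "open W" "y \<in> W"
  shows "\<exists>g :: 'x \<Rightarrow> real. continuous_on UNIV g \<and> (\<forall>x. 0 \<le> g x \<and> g x \<le> 1) \<and> g y = 1 \<and>
    (\<forall>x. x \<notin> W \<longrightarrow> g x = 0)"
proof -
  have "Hausdorff_space (euclidean :: 'x topology)"
    by (auto simp: Hausdorff_space_def disjnt_def) (metis hausdorff)
  then have "normal_space (euclidean :: 'x topology)"
    using compact_space by (intro compact_Hausdorff_or_regular_imp_normal_space)
      (simp_all add: compact_space_def)
  moreover have "disjnt {y} (- W)" using assms by simp
  ultimately obtain f :: "'x \<Rightarrow> real" where f: "continuous_map euclidean euclideanreal f"
      "f ` {y} \<subseteq> {1}" "f ` (- W) \<subseteq> {0}"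
    using Urysohn_lemma_alt[of "euclidean :: 'x topology" "{y}" "- W" 1 0] assms(1)
    by (metis closed_Compl closed_closedin closed_singleton)
  show ?thesis
  proof (intro exI[of _ "\<lambda>x. max 0 (min 1 (f x))"] conjI)
    show "continuous_on UNIV (\<lambda>x. max 0 (min 1 (f x)))"
      using f(1) by (auto intro!: continuous_intros)
  qed (use f in auto)
qed

definition real_bc :: "('x \<Rightarrow> real) \<Rightarrow> ('x \<Rightarrow>\<^sub>C complex)" where
  "real_bc g = Bcontfun (\<lambda>x. complex_of_real (g x))"

lemma apply_real_bc:
  assumes "continuous_on UNIV g" "\<forall>x. 0 \<le> g x \<and> g x \<le> 1"
  shows "apply_bcontfun (real_bc g) = (\<lambda>x. complex_of_real (g x))"
proof -
  have "(\<lambda>x. complex_of_real (g x)) \<in> bcontfun"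
    by (rule bcontfun_normI[of _ 1]) (use assms in \<open>auto intro!: continuous_intros\<close>)
  then show ?thesis by (simp add: real_bc_def Bcontfun_inverse)
qed

section \<open>Disjoint ideals for non-transitive and for finite systems\<close>

text \<open>
  If no translate of \<open>U\<close> meets \<open>V\<close>, take functions \<open>c\<close> and \<open>d\<close> supported in \<open>U\<close> and in \<open>V\<close>. Every
  coefficient of \<open>d x c\<close> is of the form \<open>d \<cdot> x(n) \<cdot> \<alpha>\<^sup>n(c)\<close>, and \<open>\<alpha>\<^sup>n(c)\<close> is supported in
  \<open>\<sigma>\<^sup>n(U)\<close>.
\<close>

lemma disjoint_ideals_not_transitive:
  assumes "\<not> topologically_transitive \<sigma>"
  shows "\<exists>I J. closed_ideal \<sigma> I \<and> self_adjoint \<sigma> I \<and> I \<noteq> {\<lambda>n. 0} \<and>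
    closed_ideal \<sigma> J \<and> self_adjoint \<sigma> J \<and> J \<noteq> {\<lambda>n. 0} \<and> I \<inter> J = {\<lambda>n. 0}"
proof -
  obtain U V y z where UV: "open U" "y \<in> U" "open V" "z \<in> V" "\<And>n. T n ` U \<inter> V = {}"
    using assms unfolding topologically_transitive_def by blast
  from ex_bump[OF UV(1,2)] obtain g :: "'x \<Rightarrow> real" where g: "continuous_on UNIV g" "\<forall>x. 0 \<le> g x \<and> g x \<le> 1"
      "g y = 1" "\<forall>x. x \<notin> U \<longrightarrow> g x = 0" by (elim exE conjE)
  from ex_bump[OF UV(3,4)] obtain h :: "'x \<Rightarrow> real" where h: "continuous_on UNIV h" "\<forall>x. 0 \<le> h x \<and> h x \<le> 1"
      "h z = 1" "\<forall>x. x \<notin> V \<longrightarrow> h x = 0" by (elim exE conjE)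
  define c where "c = single 0 (real_bc g)"
  define d where "d = single 0 (real_bc h)"
  note app = apply_real_bc[OF g(1,2)] apply_real_bc[OF h(1,2)]
  have "apply_bcontfun (c 0) y \<noteq> apply_bcontfun 0 y" "apply_bcontfun (d 0) z \<noteq> apply_bcontfun 0 z"
    by (simp_all add: c_def d_def app g(3) h(3))
  then have ne: "c \<noteq> (\<lambda>n. 0)" "d \<noteq> (\<lambda>n. 0)" by auto
  have mem: "c \<in> ell1" "d \<in> ell1" by (simp_all add: c_def d_def)
  have star: "star c = c"
    by (rule ell1_eqI) (simp add: apply_star c_def single_def app)
  have "d \<star> (x \<star> c) = (\<lambda>n. 0)" if x: "x \<in> ell1" for x
  proof (rule ell1_eqI)
    fix n w
    have "h w * g (T (- n) w) = 0"
    proof (rule ccontr)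
      assume "h w * g (T (- n) w) \<noteq> 0"
      then have "w \<in> V" "T (- n) w \<in> U" using g(4) h(4) by (metis mult_zero_left mult_zero_right)+
      then have "w \<in> T n ` U \<inter> V" by (auto intro: image_eqI[of _ _ "T (- n) w"])
      then show False using UV(5) by blast
    qed
    then have "complex_of_real (h w) * complex_of_real (g (T (- n) w)) = 0"
      by (simp flip: of_real_mult)
    then show "apply_bcontfun ((d \<star> (x \<star> c)) n) w = apply_bcontfun 0 w"
      using x by (auto simp: c_def d_def apply_single_conv apply_conv_single ell1_conv app)
  qed
  from disjoint_ideals_of_zero_product[OF mem(1) star ne(1) mem(2) ne(2) this] show ?thesis .
qed

text \<open>
  There are only finitely many maps from \<open>X\<close> to itself, so two iterates of \<open>\<sigma>\<close> coincide.
\<close>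

lemma ex_period:
  assumes "finite (UNIV :: 'x set)"
  obtains p :: int where "p > 0" "\<And>k x. p dvd k \<Longrightarrow> T k x = x"
proof -
  have "finite (UNIV :: ('x \<Rightarrow> 'x) set)"
    using assms by (simp add: finite_UNIV_fun)
  then have "\<not> inj (\<lambda>n :: nat. T (int n))"
    by (metis finite_subset infinite_UNIV_nat range_inj_infinite top_greatest)
  then obtain i j :: nat where "i \<noteq> j" "T (int i) = T (int j)" by (auto simp: inj_def)
  then obtain i j :: nat where ij: "i < j" "T (int i) = T (int j)" by (metis linorder_neqE_nat)
  define p where "p = int j - int i"
  have p: "T p x = x" for x
  proof -
    have "T p x = T (- int i) (T (int j) x)"
      using T_add[of "- int i" "int j" x] by (simp add: p_def)
    also have "\<dots> = x"
      by (simp only: fun_cong[OF ij(2), of x, symmetric] T_minus)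
    finally show ?thesis .
  qed
  have pm: "T (m * p) x = x" for m x
  proof (induction m rule: int_induct[where k = 0])
    case (step1 i)
    then show ?case using T_add[of p "i * p" x] p by (simp add: algebra_simps)
  next
    case (step2 i)
    then show ?case using T_add[of p "(i - 1) * p" x] p by (simp add: algebra_simps)
  qed simp
  show ?thesis
  proof (rule that[of p])
    show "T k x = x" if "p dvd k" for k x
      using that pm by (auto simp: dvd_def mult.commute)
  qed (use ij in \<open>simp add: p_def\<close>)
qed

lemma central_if_constant:
  fixes x :: "int \<Rightarrow> ('x \<Rightarrow>\<^sub>C complex)"
  assumes s: "(\<lambda>k. const_bcontfun (s k) :: 'x \<Rightarrow>\<^sub>C complex) \<in> ell1" and "\<And>k x. s k \<noteq> 0 \<Longrightarrow> T k x = x" and x: "x \<in> ell1"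
  shows "(\<lambda>k. const_bcontfun (s k)) \<star> x = x \<star> (\<lambda>k. const_bcontfun (s k))"
proof (rule ell1_eqI)
  fix n z
  have fix': "s k * apply_bcontfun f (T (- k) z) = s k * apply_bcontfun f z" for k f
    using assms(2)[of k] by (metis T_minus(1) mult_zero_left)
  show "apply_bcontfun (((\<lambda>k. const_bcontfun (s k)) \<star> x) n) z = apply_bcontfun ((x \<star> (\<lambda>k. const_bcontfun (s k))) n) z"
    unfolding apply_conv[OF s x] apply_conv[OF x s] const_bcontfun.rep_eq fix'
    by (rule infsum_reindex_bij_witness[where i = "\<lambda>k. n - k" and j = "\<lambda>k. n - k"]) auto
qed

text \<open>
  With \<open>\<sigma>\<^sup>p = id\<close>, the element \<open>\<delta>\<^sup>p\<close> is central, and the constant functions together with \<open>\<delta>\<^sup>p\<close>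
  generate a central copy of the Wiener algebra of absolutely convergent Fourier series
  (\<open>\<delta>\<^sup>p\<close> corresponds to \<open>e\<^sup>i\<^sup>\<theta>\<close>). That algebra has zero divisors: \<open>\<bar>sin\<bar> + sin\<close> and
  \<open>\<bar>sin\<bar> - sin\<close> have product \<open>\<bar>sin\<bar>\<^sup>2 - sin\<^sup>2 = 0\<close>. Up to the factor \<open>- \<pi>\<close>, the elements \<open>E\<close>
  and \<open>Q\<close> of the proof are \<open>\<bar>sin\<bar>\<close> and \<open>sin\<close>.
\<close>

lemma disjoint_ideals_finite:
  assumes "finite (UNIV :: 'x set)"
  shows "\<exists>I J. closed_ideal \<sigma> I \<and> self_adjoint \<sigma> I \<and> I \<noteq> {\<lambda>n. 0} \<and>
    closed_ideal \<sigma> J \<and> self_adjoint \<sigma> J \<and> J \<noteq> {\<lambda>n. 0} \<and> I \<inter> J = {\<lambda>n. 0}"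
proof -
  obtain p where p: "p > 0" "\<And>k x. p dvd k \<Longrightarrow> T k x = x" using ex_period[OF assms] by blast
  define e where "e = (\<lambda>k. if 2 * p dvd k then complex_of_real (abs_sine_coeff (k div (2 * p))) else 0)"
  define E :: "int \<Rightarrow> ('x \<Rightarrow>\<^sub>C complex)" where "E = (\<lambda>k. const_bcontfun (e k))"
  define \<kappa> where "\<kappa> = \<i> * complex_of_real (sqrt odd_recip_norm)"
  define q where "q = (\<lambda>k. if k = p then \<kappa> else if k = - p then - \<kappa> else 0)"
  define Q :: "int \<Rightarrow> ('x \<Rightarrow>\<^sub>C complex)" where "Q = (\<lambda>k. const_bcontfun (q k))"
  have \<kappa>: "\<kappa> * \<kappa> = - complex_of_real odd_recip_norm" "cnj \<kappa> = - \<kappa>" "\<kappa> \<noteq> 0"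
  proof -
    have "\<kappa>\<^sup>2 = - complex_of_real ((sqrt odd_recip_norm)\<^sup>2)"
      by (simp only: \<kappa>_def power_mult_distrib power2_i of_real_power mult_minus_left mult_1_left)
    then show "\<kappa> * \<kappa> = - complex_of_real odd_recip_norm"
      using odd_recip_norm_pos by (simp add: power2_eq_square)
  qed (use odd_recip_norm_pos in \<open>auto simp: \<kappa>_def\<close>)
  have norm_const: "norm (const_bcontfun z :: 'x \<Rightarrow>\<^sub>C complex) \<le> norm z" for z :: complex
    by (rule norm_bound) (simp add: const_bcontfun.rep_eq)
  have multiples: "infsum f UNIV = (\<Sum>\<^sub>\<infinity>m. f (2 * p * m))" "f summable_on UNIV \<longleftrightarrow> (\<lambda>m. f (2 * p * m)) summable_on UNIV"
    if "\<And>k. \<not> 2 * p dvd k \<Longrightarrow> f k = 0" for f :: "int \<Rightarrow> 'b :: {topological_comm_monoid_add, t2_space}"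
  proof -
    have "bij_betw (\<lambda>m. 2 * p * m) UNIV {k. 2 * p dvd k}"
      using p(1) by (auto simp: bij_betw_def inj_on_def dvd_def)
    note * = infsum_reindex_bij_betw[OF this, of f] summable_on_reindex_bij_betw[OF this, of f]
    show "infsum f UNIV = (\<Sum>\<^sub>\<infinity>m. f (2 * p * m))"
      unfolding *(1) by (rule infsum_cong_neutral) (use that in auto)
    show "f summable_on UNIV \<longleftrightarrow> (\<lambda>m. f (2 * p * m)) summable_on UNIV"
      unfolding *(2) by (rule summable_on_cong_neutral) (use that in auto)
  qed
  have E: "E \<in> ell1"
  proof (rule ell1I_comparison(1))
    show "(\<lambda>k. norm (e k)) summable_on UNIV"
      using abs_sine_coeff_summable p(1) by (subst multiples(2)) (auto simp: e_def)
    show "norm (E k) \<le> norm (e k)" for k unfolding E_def by (rule norm_const)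
  qed
  have Q_single: "Q = (\<lambda>k. single p (const_bcontfun \<kappa>) k + single (- p) (const_bcontfun (- \<kappa>)) k)"
    by (rule ell1_eqI) (use p(1) in \<open>auto simp: Q_def q_def single_def const_bcontfun.rep_eq\<close>)
  then have Q: "Q \<in> ell1" by (simp add: ell1_add)
  have E_central: "E \<star> x = x \<star> E" if "x \<in> ell1" for x
    unfolding E_def
  proof (rule central_if_constant[OF E[unfolded E_def] _ that])
    show "T k z = z" if "e k \<noteq> 0" for k z
      using that by (intro p(2)) (auto simp: e_def split: if_splits elim: dvd_mult_right)
  qed
  have Q_central: "Q \<star> x = x \<star> Q" if "x \<in> ell1" for x
    unfolding Q_def
  proof (rule central_if_constant[OF Q[unfolded Q_def] _ that])
    show "T k z = z" if "q k \<noteq> 0" for k z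
      using that by (intro p(2)) (auto simp: q_def split: if_splits)
  qed
  have EE_QQ: "E \<star> E = Q \<star> Q"
  proof (rule ell1_eqI)
    fix n z
    have "apply_bcontfun ((E \<star> E) n) z = (\<Sum>\<^sub>\<infinity>k. e k * e (n - k))"
      by (subst apply_conv[OF E E]) (simp add: E_def const_bcontfun.rep_eq)
    also have "\<dots> = (\<Sum>\<^sub>\<infinity>m. e (2 * p * m) * e (n - 2 * p * m))"
      by (rule multiples) (simp add: e_def)
    also have "\<dots> = (if n = 0 then 2 * odd_recip_norm else if n = 2 * p \<or> n = - 2 * p then - odd_recip_norm else 0)"
    proof (cases "2 * p dvd n")
      case True
      then obtain N where N: "n = 2 * p * N" by blast
      have 1: "e (2 * p * m) * e (n - 2 * p * m) = complex_of_real (abs_sine_coeff m * abs_sine_coeff (N - m))" for m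
      proof -
        have "n - 2 * p * m = 2 * p * (N - m)" by (simp add: N algebra_simps)
        then show ?thesis using p(1) by (simp add: e_def)
      qed
      have "(\<Sum>\<^sub>\<infinity>m. e (2 * p * m) * e (n - 2 * p * m))
          = complex_of_real (odd_recip_norm * (if N = 0 then 2 else if N = 1 \<or> N = - 1 then - 1 else 0))"
        unfolding 1 by (intro infsumI has_sum_of_real abs_sine_coeff_conv)
      moreover have "2 * p * N = 2 * p * M \<longleftrightarrow> N = M" for M
        using p(1) by simp
      from this[of 0] this[of 1] this[of "- 1"]
      have "n = 0 \<longleftrightarrow> N = 0" "n = 2 * p \<longleftrightarrow> N = 1" "n = - 2 * p \<longleftrightarrow> N = - 1"
        by (simp_all add: N)
      ultimately show ?thesis by simp
    next
      case False
      then have "e (n - 2 * p * m) = 0" for m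
        by (simp add: e_def dvd_diff_left_iff)
      moreover have "n \<noteq> 0" "n \<noteq> 2 * p" "n \<noteq> - 2 * p" using False by auto
      ultimately show ?thesis by simp
    qed
    also have "\<dots> = q p * q (n - p) + q (- p) * q (n + p)"
      using p(1) \<kappa>(1) by (auto simp: q_def)
    also have "\<dots> = apply_bcontfun ((Q \<star> Q) n) z"
    proof -
      have "Q \<star> Q = (\<lambda>n. (single p (const_bcontfun \<kappa>) \<star> Q) n + (single (- p) (const_bcontfun (- \<kappa>)) \<star> Q) n)"
        using conv_add_left[OF ell1_single[of p "const_bcontfun \<kappa>"]
            ell1_single[of "- p" "const_bcontfun (- \<kappa>)"] Q]
        by (simp only: Q_single[symmetric])
      then show ?thesis
        using p(1) Q by (simp add: apply_single_conv) (simp add: Q_def q_def const_bcontfun.rep_eq)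
    qed
    finally show "apply_bcontfun ((E \<star> E) n) z = apply_bcontfun ((Q \<star> Q) n) z" .
  qed
  define c where "c = (\<lambda>k. E k + Q k)"
  define d where "d = (\<lambda>k. E k - Q k)"
  have mem: "c \<in> ell1" "d \<in> ell1" using E Q by (auto simp: c_def d_def ell1_add ell1_diff)
  \<comment> \<open>\<open>E\<close> lives on even multiples of \<open>p\<close> and \<open>Q\<close> on odd ones, so neither combination vanishes.\<close>
  have "e p = 0" using p(1) zdvd_imp_le[of "2 * p" p] by (auto simp: e_def)
  then have "apply_bcontfun (c p) undefined \<noteq> apply_bcontfun 0 undefined" "apply_bcontfun (d p) undefined \<noteq> apply_bcontfun 0 undefined"
    using \<kappa>(3) by (auto simp: c_def d_def E_def Q_def q_def const_bcontfun.rep_eq)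
  then have ne: "c \<noteq> (\<lambda>n. 0)" "d \<noteq> (\<lambda>n. 0)" by auto
  have "cnj (e (- k)) = e k" "cnj (q (- k)) = q k" for k
  proof -
    have "e (- k) = e k"
    proof (cases "2 * p dvd k")
      case True
      then obtain m where "k = 2 * p * m" by blast
      then show ?thesis
        using p(1) abs_sine_coeff_even[of m] by (simp add: e_def flip: mult_minus_right)
    qed (simp add: e_def)
    then show "cnj (e (- k)) = e k" by (simp add: e_def)
    show "cnj (q (- k)) = q k" using p(1) \<kappa>(2) by (auto simp: q_def)
  qed
  then have star: "star c = c"
    by (intro ell1_eqI) (simp add: apply_star c_def E_def Q_def const_bcontfun.rep_eq)
  have "d \<star> (x \<star> c) = (\<lambda>n. 0)" if x: "x \<in> ell1" for x
  proof -
    have "x \<star> c = c \<star> x"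
      using E Q x by (simp add: c_def conv_add_left conv_add_right E_central Q_central)
    then have "d \<star> (x \<star> c) = (d \<star> c) \<star> x"
      using mem x by (simp add: conv_assoc)
    also have "d \<star> c = (\<lambda>n. (E \<star> E) n + (E \<star> Q) n - ((Q \<star> E) n + (Q \<star> Q) n))"
      using E Q by (simp add: c_def d_def conv_diff_left conv_add_right ell1_add)
    also have "\<dots> = (\<lambda>n. 0)" by (simp add: EE_QQ Q_central[OF E])
    finally show ?thesis by (simp add: conv_zero)
  qed
  from disjoint_ideals_of_zero_product[OF mem(1) star ne(1) mem(2) ne(2) this] show ?thesis .
qed

section \<open>Aperiodic behaviour of infinite transitive systems\<close>

text \<open>
  Suppose that \<open>\<sigma>\<^sup>n\<close> is the identity on \<open>U\<close>, and let \<open>x \<in> U\<close>. Then \<open>x\<close> has a finite orbit, and as \<open>X\<close>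
  is infinite there is a point \<open>y\<close> off that orbit. Separating \<open>y\<close> from the finitely many points of the
  orbit gives neighbourhoods \<open>B\<close> of \<open>y\<close> and \<open>A \<subseteq> U\<close> of \<open>x\<close> such that \<open>\<sigma>\<^sup>k(A)\<close> misses \<open>B\<close> for
  \<open>0 \<le> k < n\<close>, and hence for all \<open>k\<close>, because only \<open>k\<close> modulo \<open>n\<close> matters on \<open>A\<close>. This contradicts
  transitivity.
\<close>

lemma ex_moved_point_pos:
  assumes inf: "infinite (UNIV :: 'x set)" and trans: "topologically_transitive \<sigma>"
    and n: "n > 0" and U: "open U" "U \<noteq> {}"
  shows "\<exists>y\<in>U. T n y \<noteq> y"
proof (rule ccontr)
  assume "\<not> ?thesis"
  then have per: "T n w = w" if "w \<in> U" for w using that by blast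
  obtain x where x: "x \<in> U" using U by blast
  have "\<exists>y. y \<notin> (\<lambda>k. T k x) ` {0..<n}"
    by (rule ex_new_if_finite[OF inf]) simp
  then obtain y where y: "y \<notin> (\<lambda>k. T k x) ` {0..<n}" ..
  have "\<forall>k\<in>{0..<n}. \<exists>P. open (fst P) \<and> open (snd P) \<and> T k x \<in> fst P \<and> y \<in> snd P \<and> fst P \<inter> snd P = {}"
  proof
    fix k assume "k \<in> {0..<n}"
    then have "T k x \<noteq> y" using y by blast
    from hausdorff[OF this] show "\<exists>P. open (fst P) \<and> open (snd P) \<and> T k x \<in> fst P \<and> y \<in> snd P \<and> fst P \<inter> snd P = {}"
      by force
  qed
  then obtain P where P: "\<And>k. k \<in> {0..<n} \<Longrightarrow> open (fst (P k)) \<and> open (snd (P k)) \<and> T k x \<in> fst (P k) \<and> y \<in> snd (P k) \<and> fst (P k) \<inter> snd (P k) = {}"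
    by (metis bchoice)
  define A where "A = U \<inter> (\<Inter>k\<in>{0..<n}. T k -` fst (P k))"
  define B where "B = (\<Inter>k\<in>{0..<n}. snd (P k))"
  have "open A" unfolding A_def
    using P by (intro open_Int U open_INT) (auto intro: open_vimage continuous_T)
  moreover have "open B" unfolding B_def using P by (intro open_INT) auto
  moreover have "x \<in> A" "y \<in> B" using P x by (auto simp: A_def B_def)
  ultimately obtain m where "T m ` A \<inter> B \<noteq> {}"
    using trans unfolding topologically_transitive_def by blast
  then obtain w where w: "w \<in> A" "T m w \<in> B" by blast
  have "T (n * q) w = w" for q
  proof (induction q rule: int_induct[where k = 0])
    case (step1 i)
    then show ?case using T_add[of n "n * i" w] per[of w] w by (simp add: algebra_simps A_def)
  next
    case (step2 i)
    have "T (n * i) w = T n (T (n * (i - 1)) w)" using T_add[of n "n * (i - 1)" w] by (simp add: algebra_simps)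
    then have "T (- n) (T (n * i) w) = T (n * (i - 1)) w" by simp
    moreover have "T (- n) w = w" using per[of w] w by (metis T_minus(1) A_def IntD1)
    ultimately show ?case using step2 by simp
  qed simp
  then have "T m w = T (m mod n) w"
    using T_add[of "m mod n" "n * (m div n)" w] by simp
  moreover have m: "m mod n \<in> {0..<n}" using n by simp
  moreover have "T (m mod n) w \<in> fst (P (m mod n))" using w(1) m unfolding A_def by blast
  moreover have "T m w \<in> snd (P (m mod n))" using w(2) m unfolding B_def by blast
  ultimately have "T (m mod n) w \<in> fst (P (m mod n)) \<inter> snd (P (m mod n))" by simp
  then show False using P[OF m] by simp
qed

text \<open>
  Only finitely many exponents occur, so it is enough to pass successively to smaller nonempty open
  sets on which one more of the powers \<open>\<sigma>\<^sup>k\<close> has no fixed point.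
\<close>

lemma ex_moved_point:
  assumes inf: "infinite (UNIV :: 'x set)" and trans: "topologically_transitive \<sigma>"
    and "finite F" "0 \<notin> F" and U: "open U" "U \<noteq> {}"
  shows "\<exists>y\<in>U. \<forall>k\<in>F. T k y \<noteq> y"
  using assms(3-)
proof (induction F arbitrary: U rule: finite_induct)
  case (insert k F)
  define V where "V = U \<inter> - {y. T k y = y}"
  have "open V"
    unfolding V_def using insert.prems
    by (intro open_Int open_Compl closed_Collect_eq continuous_T continuous_on_id) auto
  moreover have "V \<noteq> {}"
  proof (cases "k > 0")
    case True
    then show ?thesis using ex_moved_point_pos[OF inf trans True insert.prems(2,3)] by (auto simp: V_def)
  next
    case False
    then have "- k > 0" using insert.prems by auto
    from ex_moved_point_pos[OF inf trans this insert.prems(2,3)] obtain y where y: "y \<in> U" "T (- k) y \<noteq> y" by blast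
    then have "T k y \<noteq> y" by (metis T_minus(1))
    then show ?thesis using y by (auto simp: V_def)
  qed
  ultimately obtain y where "y \<in> V" "\<forall>k\<in>F. T k y \<noteq> y" using insert.IH[of V] insert.prems by blast
  then show ?case by (auto simp: V_def)
qed blast

lemma ex_wandering_nbhd:
  assumes "finite F" "\<forall>k\<in>F. T k y \<noteq> y" "open U" "y \<in> U"
  shows "\<exists>W. open W \<and> y \<in> W \<and> W \<subseteq> U \<and> (\<forall>k\<in>F. \<forall>w\<in>W. T (- k) w \<notin> W)"
  using assms
proof (induction F rule: finite_induct)
  case (insert k F)
  then obtain W where W: "open W" "y \<in> W" "W \<subseteq> U" "\<forall>k\<in>F. \<forall>w\<in>W. T (- k) w \<notin> W" by auto
  have "T (- k) y \<noteq> y" using insert.prems by (metis T_minus(2) insertI1)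
  from hausdorff[OF this] obtain B A where AB: "open B" "open A" "T (- k) y \<in> B" "y \<in> A" "B \<inter> A = {}" by blast
  show ?case
  proof (intro exI[of _ "W \<inter> A \<inter> T (- k) -` B"] conjI)
    show "open (W \<inter> A \<inter> T (- k) -` B)"
      using W AB by (intro open_Int open_vimage continuous_T) auto
  qed (use W AB in auto)
qed auto

section \<open>Closed ideals of infinite transitive systems\<close>

text \<open>
  Normalise an element \<open>a\<close> of the ideal so that \<open>a(0)\<close> takes the value \<open>1\<close> somewhere. The
  coefficients outside a finite set \<open>F\<close> are small, and near a suitable point \<open>y\<close> the function \<open>a(0)\<close>
  is close to \<open>1\<close> while \<open>y\<close> is moved by all \<open>\<sigma>\<^sup>k\<close> with \<open>0 \<noteq> k \<in> F\<close>. Compressing \<open>a\<close> by a function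
  \<open>f\<close> with small support around \<open>y\<close> removes those coefficients, so that \<open>b = f a f\<close> is within
  distance \<open>1/2\<close> of the function \<open>f\<^sup>2\<close>.
  
  Now let \<open>H\<close> be a nonzero function supported where \<open>f = 1\<close>, and put \<open>r = f\<^sup>2 - b\<close>. From
  \<open>f\<^sup>2 H = H\<close> one gets \<open>H - r H = b H \<in> I\<close>, hence \<open>H - r\<^sup>n H \<in> I\<close> for all \<open>n\<close>. As \<open>\<parallel>r\<parallel> \<le> 1/2\<close>, these
  elements converge to \<open>H\<close>, and \<open>H \<in> I\<close> because \<open>I\<close> is closed.
\<close>

lemma closed_ideal_contains_function:
  assumes inf: "infinite (UNIV :: 'x set)" and trans: "topologically_transitive \<sigma>"
    and I: "closed_ideal \<sigma> I" and ne: "I \<noteq> {\<lambda>n. 0}"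
  shows "\<exists>h. h \<noteq> 0 \<and> single 0 h \<in> I"
proof -
  have sub: "a \<in> ell1" if "a \<in> I" for a using I that by (auto simp: closed_ideal_iff)
  have zero: "(\<lambda>n. 0) \<in> I" using I by (simp add: closed_ideal_iff)
  have diff: "(\<lambda>n. a n - b n) \<in> I" if "a \<in> I" "b \<in> I" for a b using I that by (simp add: closed_ideal_iff)
  have add: "(\<lambda>n. a n + b n) \<in> I" if "a \<in> I" "b \<in> I" for a b
    using diff[OF that(1) diff[OF zero that(2)]] by simp
  have mult: "a \<star> b \<in> I" "b \<star> a \<in> I" if "a \<in> I" "b \<in> ell1" for a b using I that by (auto simp: closed_ideal_iff)
  have "\<exists>a\<in>I. a \<noteq> (\<lambda>n. 0)" using ne zero by blast
  then obtain a' where a': "a' \<in> I" "a' \<noteq> (\<lambda>n. 0)" by blast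
  then obtain k0 x0 where kx: "apply_bcontfun (a' k0) x0 \<noteq> 0"
    using ell1_eqI[of a' "\<lambda>n. 0"] by auto
  define a where "a = a' \<star> single (- k0) (const_bcontfun (1 / apply_bcontfun (a' k0) x0))"
  have aI: "a \<in> I" unfolding a_def by (rule mult(1)[OF a'(1) ell1_single])
  then have a: "a \<in> ell1" by (rule sub)
  have a0: "apply_bcontfun (a 0) x0 = 1"
    using kx by (simp add: a_def apply_conv_single sub[OF a'(1)] const_bcontfun.rep_eq)
  define U where "U = {x. norm (apply_bcontfun (a 0) x - 1) < 1 / 4}"
  have U: "open U" "U \<noteq> {}"
    unfolding U_def using a0 by (auto intro!: open_Collect_less continuous_intros exI[of _ x0])
  obtain F0 where F0: "finite F0" "dist (\<Sum>k\<in>F0. norm (a k)) (ell1_norm a) \<le> 1 / 4"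
    using infsum_finite_approximation[OF ell1D[OF a], of "1 / 4"] by (auto simp: ell1_norm_def)
  define F where "F = insert 0 F0"
  have F: "finite F" "0 \<in> F" using F0 by (auto simp: F_def)
  define t where "t = ell1_norm a - (\<Sum>k\<in>F. norm (a k))"
  have "(\<Sum>k\<in>F0. norm (a k)) \<le> (\<Sum>k\<in>F. norm (a k))"
    by (rule sum_mono2) (use F0 in \<open>auto simp: F_def\<close>)
  then have t: "t \<le> 1 / 4" using F0(2) unfolding t_def dist_real_def by linarith
  have tail: "((\<lambda>k. if k \<in> F then 0 else norm (a k)) has_sum t) UNIV"
  proof -
    have "((\<lambda>k. norm (a k)) has_sum t) (UNIV - F)"
      unfolding t_def ell1_norm_def using F by (intro has_sum_Diff has_sum_infsum ell1D[OF a]) auto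
    then show ?thesis
      by (rule has_sum_cong_neutral[THEN iffD1, rotated -1]) auto
  qed
  obtain y where y: "y \<in> U" "\<forall>k\<in>F - {0}. T k y \<noteq> y"
    using ex_moved_point[OF inf trans, of "F - {0}" U] F U by auto
  obtain W where W: "open W" "y \<in> W" "W \<subseteq> U" "\<forall>k\<in>F - {0}. \<forall>w\<in>W. T (- k) w \<notin> W"
    using ex_wandering_nbhd[OF _ y(2) U(1) y(1)] F by auto
  from ex_bump[OF W(1,2)] obtain g :: "'x \<Rightarrow> real" where g: "continuous_on UNIV g"
      "\<forall>x. 0 \<le> g x \<and> g x \<le> 1" "g y = 1" "\<forall>x. x \<notin> W \<longrightarrow> g x = 0" by (elim exE conjE)
  \<comment> \<open>On the support of \<open>h\<close> one has \<open>g \<ge> 1/2\<close>, and there \<open>f = 1\<close>.\<close>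
  define f where "f = (\<lambda>x. min 1 (2 * g x))"
  define h where "h = (\<lambda>x. max 0 (2 * g x - 1))"
  have f: "continuous_on UNIV f" "\<forall>x. 0 \<le> f x \<and> f x \<le> 1" and f_W: "\<And>x. x \<notin> W \<Longrightarrow> f x = 0"
    using g by (auto simp: f_def intro!: continuous_intros)
  have h: "continuous_on UNIV h" "\<forall>x. 0 \<le> h x \<and> h x \<le> 1"
    using g by (auto simp: h_def intro!: continuous_intros)
  have fh: "f x * (f x * h x) = h x" for x by (auto simp: f_def h_def max_def min_def)
  note app = apply_real_bc[OF f] apply_real_bc[OF h]
  define e where "e = single 0 (bc_mult (real_bc f) (real_bc f))"
  define b where "b = single 0 (real_bc f) \<star> (a \<star> single 0 (real_bc f))"
  define r where "r = (\<lambda>n. e n - b n)"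
  define H where "H = single 0 (real_bc h)"
  have bI: "b \<in> I" unfolding b_def by (intro mult aI ell1_single)
  have mem: "b \<in> ell1" "e \<in> ell1" "r \<in> ell1" "H \<in> ell1"
    using sub[OF bI] by (simp_all add: e_def r_def H_def ell1_diff)
  have apply_r: "apply_bcontfun (r k) x =
      (if k = 0 then of_real (f x) * of_real (f x) else 0) - of_real (f x) * (a k x * of_real (f (T (- k) x)))" for k x
    by (simp add: r_def e_def b_def apply_single_conv apply_conv_single ell1_conv a app)
       (simp add: single_def app)
  have norm_r: "ell1_norm r \<le> 1 / 2"
  proof -
    let ?\<rho> = "\<lambda>k. (if k \<in> F then 0 else norm (a k)) + (if k = 0 then 1 / 4 else 0)"
    have "((\<lambda>k :: int. if k = 0 then 1 / 4 else 0 :: real) has_sum (1 / 4)) UNIV"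
      by (rule has_sum_finite_neutralI[of "{0}"]) auto
    from has_sum_add[OF tail this] have \<rho>: "(?\<rho> has_sum (t + 1 / 4)) UNIV" .
    have "norm (r k) \<le> ?\<rho> k" for k
    proof (rule norm_bound)
      fix x
      show "norm (apply_bcontfun (r k) x) \<le> ?\<rho> k"
      proof (cases "k \<in> F")
        case False
        then have "k \<noteq> 0" using F by blast
        have "f x * (norm (apply_bcontfun (a k) x) * f (T (- k) x)) \<le> 1 * (norm (a k) * 1)"
          using f(2) by (intro mult_mono norm_bounded) auto
        then show ?thesis
          using f(2) \<open>k \<noteq> 0\<close> False by (simp add: apply_r norm_mult)
      next
        case True
        show ?thesis
        proof (cases "k = 0")
          case True
          have "apply_bcontfun (r k) x = of_real (f x * f x) * (1 - apply_bcontfun (a 0) x)"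
            using True by (simp add: apply_r algebra_simps)
          then have eq: "norm (apply_bcontfun (r k) x) = f x * f x * norm (apply_bcontfun (a 0) x - 1)"
            by (simp add: norm_mult norm_minus_commute)
          have "f x * f x * norm (apply_bcontfun (a 0) x - 1) \<le> 1 / 4"
          proof (cases "x \<in> W")
            case True
            then have "norm (apply_bcontfun (a 0) x - 1) \<le> 1 / 4" using W(3) by (auto simp: U_def)
            moreover have "f x * f x \<le> 1" using f(2) by (simp add: mult_le_one)
            ultimately have "f x * f x * norm (apply_bcontfun (a 0) x - 1) \<le> 1 * (1 / 4)"
              using f(2) by (intro mult_mono) auto
            then show ?thesis by simp
          qed (simp add: f_W)
          then show ?thesis using eq True F by simp
        next
          case False
          then have "f x * f (T (- k) x) = 0"
            using W(4) f_W \<open>k \<in> F\<close> by (metis DiffI mult_eq_0_iff singletonD)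
          then have "apply_bcontfun (r k) x = 0"
            using False by (auto simp: apply_r)
          then show ?thesis using True False by simp
        qed
      qed
    qed
    with \<rho> have "ell1_norm r \<le> infsum ?\<rho> UNIV"
      by (intro ell1I_comparison(2)[where g = ?\<rho> and a = r] has_sum_imp_summable)
    then show ?thesis using t infsumI[OF \<rho>] by simp
  qed
  have eH: "e \<star> H = H"
  proof (rule ell1_eqI)
    fix n x
    have "complex_of_real (f x) * of_real (f x) * of_real (h x) = of_real (h x)"
      unfolding of_real_mult[symmetric] mult.assoc fh ..
    then show "apply_bcontfun ((e \<star> H) n) x = apply_bcontfun (H n) x"
      unfolding e_def H_def apply_single_conv[OF ell1_single] by (simp add: single_def app)
  qed
  define P where "P = (\<lambda>n. ((\<lambda>c. r \<star> c) ^^ n) H)"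
  have P_ell1: "P n \<in> ell1" for n
    by (induction n) (auto simp: P_def mem ell1_conv)
  have P_norm: "ell1_norm (P n) \<le> (1 / 2) ^ n * ell1_norm H" for n
  proof (induction n)
    case (Suc n)
    have "ell1_norm (P (Suc n)) \<le> ell1_norm r * ell1_norm (P n)"
      using ell1_norm_conv[OF mem(3) P_ell1[of n]] by (simp add: P_def)
    also have "\<dots> \<le> 1 / 2 * ((1 / 2) ^ n * ell1_norm H)"
      by (intro mult_mono norm_r Suc ell1_norm_nonneg) simp
    finally show ?case by simp
  qed (simp add: P_def)
  have P_I: "(\<lambda>k. H k - P n k) \<in> I" for n
  proof (induction n)
    case 0
    then show ?case using zero by (simp add: P_def)
  next
    case (Suc n)
    have "r \<star> H = (\<lambda>k. H k - (b \<star> H) k)"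
      unfolding r_def by (subst conv_diff_left[OF mem(2,1,4)]) (simp add: eH)
    moreover have "r \<star> (\<lambda>k. H k - P n k) = (\<lambda>k. (r \<star> H) k - P (Suc n) k)"
      by (subst conv_diff_right[OF mem(3,4) P_ell1]) (simp add: P_def)
    ultimately have "(\<lambda>k. H k - P (Suc n) k) = (\<lambda>k. (b \<star> H) k + (r \<star> (\<lambda>k. H k - P n k)) k)"
      by (simp add: fun_eq_iff)
    also have "\<dots> \<in> I"
      by (intro add mult bI mem Suc)
    finally show ?case .
  qed
  have "H \<in> I"
  proof (rule ccontr)
    assume "H \<notin> I"
    then obtain \<epsilon> where \<epsilon>: "\<epsilon> > 0" "\<And>c. c \<in> I \<Longrightarrow> \<epsilon> \<le> ell1_norm (\<lambda>k. H k - c k)"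
      using I mem(4) unfolding closed_ideal_iff by (metis DiffI)
    have pos: "ell1_norm H + 1 > 0" using ell1_norm_nonneg[of H] by simp
    obtain n where n: "(1 / 2) ^ n < \<epsilon> / (ell1_norm H + 1)"
      using real_arch_pow_inv[of "\<epsilon> / (ell1_norm H + 1)" "1 / 2"] \<epsilon>(1) pos by auto
    have "\<epsilon> \<le> ell1_norm (P n)" using \<epsilon>(2)[OF P_I[of n]] by simp
    also have "\<dots> \<le> (1 / 2) ^ n * ell1_norm H" by (rule P_norm)
    also have "\<dots> \<le> (1 / 2) ^ n * (ell1_norm H + 1)" by (intro mult_left_mono) auto
    also have "\<dots> < \<epsilon>" using n pos by (simp add: less_divide_eq)
    finally show False by simp
  qed
  moreover have "apply_bcontfun (real_bc h) y \<noteq> apply_bcontfun 0 y"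
    unfolding app by (simp add: h_def g(3))
  ultimately show ?thesis unfolding H_def by metis
qed

text \<open>
  Pick nonzero functions \<open>f \<in> I\<close> and \<open>g \<in> J\<close>. By transitivity some \<open>\<sigma>\<^sup>n\<close> carries a point where \<open>f\<close> is
  nonzero to a point where \<open>g\<close> is nonzero, and then \<open>g \<delta>\<^sup>n f = g \<alpha>\<^sup>n(f) \<delta>\<^sup>n\<close> is a nonzero common
  element.
\<close>

lemma ideals_intersect:
  assumes inf: "infinite (UNIV :: 'x set)" and trans: "topologically_transitive \<sigma>"
    and I: "closed_ideal \<sigma> I" "I \<noteq> {\<lambda>n. 0}" and J: "closed_ideal \<sigma> J" "J \<noteq> {\<lambda>n. 0}"
  shows "I \<inter> J \<noteq> {\<lambda>n. 0}"
proof -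
  from closed_ideal_contains_function[OF inf trans I] obtain f where f: "f \<noteq> 0" "single 0 f \<in> I"
    by blast
  from closed_ideal_contains_function[OF inf trans J] obtain g where g: "g \<noteq> 0" "single 0 g \<in> J"
    by blast
  have supp: "{x. apply_bcontfun k x \<noteq> 0} \<noteq> {}" "open {x. apply_bcontfun k x \<noteq> 0}"
    if "k \<noteq> 0" for k :: "'x \<Rightarrow>\<^sub>C complex"
  proof -
    show "{x. apply_bcontfun k x \<noteq> 0} \<noteq> {}"
      using that bcontfun_eqI[of k 0] by auto
    show "open {x. apply_bcontfun k x \<noteq> 0}"
      by (intro open_Collect_neq continuous_on_apply_bcontfun continuous_on_const)
  qed
  from supp[OF f(1)] supp[OF g(1)]
  obtain n w where w: "apply_bcontfun f w \<noteq> 0" "apply_bcontfun g (T n w) \<noteq> 0"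
    using trans unfolding topologically_transitive_def by blast
  define c where "c = (single 0 g \<star> single n (const_bcontfun 1)) \<star> single 0 f"
  have "c \<in> I"
    unfolding c_def using I(1) f(2) ell1_conv[OF ell1_single ell1_single] by (simp add: closed_ideal_iff)
  moreover have c: "c = single 0 g \<star> (single n (const_bcontfun 1) \<star> single 0 f)"
    unfolding c_def by (intro conv_assoc ell1_single)
  have "c \<in> J"
    unfolding c using J(1) g(2) ell1_conv[OF ell1_single ell1_single] by (simp add: closed_ideal_iff)
  moreover have "apply_bcontfun (c n) (T n w) \<noteq> apply_bcontfun 0 (T n w)"
    using w by (simp add: c apply_single_conv ell1_conv const_bcontfun.rep_eq)
  then have "c \<noteq> (\<lambda>n. 0)" by auto
  ultimately show ?thesis by blast
qed

end

theorem theorem4p10: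
  fixes \<sigma> :: "'x::t2_space \<Rightarrow> 'x"
  assumes "compact (UNIV :: 'x set)"
    and "homeomorphism UNIV UNIV \<sigma> (inv_into UNIV \<sigma>)"
  shows "((\<forall>I1 I2. closed_ideal \<sigma> I1 \<and> I1 \<noteq> {\<zero>\<^bsub>ell1_ring \<sigma>\<^esub>} \<and>
                   closed_ideal \<sigma> I2 \<and> I2 \<noteq> {\<zero>\<^bsub>ell1_ring \<sigma>\<^esub>}
                   \<longrightarrow> I1 \<inter> I2 \<noteq> {\<zero>\<^bsub>ell1_ring \<sigma>\<^esub>})
          \<longleftrightarrow>
          (\<forall>I1 I2. closed_ideal \<sigma> I1 \<and> self_adjoint \<sigma> I1 \<and> I1 \<noteq> {\<zero>\<^bsub>ell1_ring \<sigma>\<^esub>} \<and>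
                   closed_ideal \<sigma> I2 \<and> self_adjoint \<sigma> I2 \<and> I2 \<noteq> {\<zero>\<^bsub>ell1_ring \<sigma>\<^esub>}
                   \<longrightarrow> I1 \<inter> I2 \<noteq> {\<zero>\<^bsub>ell1_ring \<sigma>\<^esub>}))
       \<and>
         ((\<forall>I1 I2. closed_ideal \<sigma> I1 \<and> self_adjoint \<sigma> I1 \<and> I1 \<noteq> {\<zero>\<^bsub>ell1_ring \<sigma>\<^esub>} \<and>
                   closed_ideal \<sigma> I2 \<and> self_adjoint \<sigma> I2 \<and> I2 \<noteq> {\<zero>\<^bsub>ell1_ring \<sigma>\<^esub>}
                   \<longrightarrow> I1 \<inter> I2 \<noteq> {\<zero>\<^bsub>ell1_ring \<sigma>\<^esub>})
          \<longleftrightarrow>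
          infinite (UNIV :: 'x set) \<and> topologically_transitive \<sigma>)"
proof -
  interpret dynamical_system \<sigma>
    by unfold_locales (fact assms)+
  let ?disjoint = "\<lambda>I J. closed_ideal \<sigma> I \<and> self_adjoint \<sigma> I \<and> I \<noteq> {\<lambda>n. 0} \<and>
    closed_ideal \<sigma> J \<and> self_adjoint \<sigma> J \<and> J \<noteq> {\<lambda>n. 0} \<and> I \<inter> J = {\<lambda>n. 0}"
  have "\<exists>I J. ?disjoint I J" if "\<not> (infinite (UNIV :: 'x set) \<and> topologically_transitive \<sigma>)"
    using that disjoint_ideals_finite disjoint_ideals_not_transitive by blast
  then show ?thesis
    unfolding ring_sel using ideals_intersect by meson
qed

end
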